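(* Consider a Borel probability measure $\mu$ on $\mathbb R$ and a real number $t\ge1$. (1) There exists a probability measure $\mu_t$ on $\mathbb R$ satisfying $\varphi_{\mu_t}(z)=t\varphi_\mu(z)$ for $z$ in the common domain of the two functions. (2) There exists an injective analytic map $\omega_t:\mathbb C^+\to\mathbb C^+$ such that $F_{\mu_t}(z)=F_\mu(\omega_t(z))$ for $z\in\mathbb C^+$. (3) We have $\omega_t(z)=\frac1t z+\left(1-\frac1t\right)F_{\mu_t}(z)$ and $H_t(\omega_t(z))=z$ for $z\in\mathbb C^+$, where $H_t(z)=tz+(1-t)F_\mu(z)$, $z\in\mathbb C^+$.
   Context: $\mathbb C^+=\{z\in\mathbb C:\Im z>0\}$. For a Borel probability measure $\mu$ on $\mathbb R$ let $G_\mu(z)=\int_{\mathbb R}\frac{d\mu(t)}{z-t}$ and $F_\mu=1/G_\mu$ on $\mathbb C^+$. For $\alpha,\beta>0$ put $\Gamma_{\alpha,\beta}=\{z\in\mathbb C^+:\Im z>\beta,\ |\Re z|<\alpha\Im z\}$. There is a nonempty domain $\Omega=\bigcup_{\alpha>0}\Gamma_{\alpha,\beta_\alpha}$ on which $F_\mu$ has a right inverse with respect to composition, $F_\mu^{-1}$, with $F_\mu^{-1}(z)/z\to1$ as $z\to\infty$, $z\in\Gamma_{\alpha,\beta}$, for all $\alpha,\beta>0$; one sets $\varphi_\mu(z)=F_\mu^{-1}(z)-z$ for $z\in\Omega$. *)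

theory Defs
  imports "HOL-Probability.Probability" "HOL-Complex_Analysis.Complex_Analysis"
begin

definition upper_half_plane :: "complex set" where
  "upper_half_plane = {z. Im z > 0}"

definition cauchy_G :: "real measure \<Rightarrow> complex \<Rightarrow> complex" where
  "cauchy_G \<mu> z = (\<integral>x. 1 / (z - of_real x) \<partial>\<mu>)"

definition recip_F :: "real measure \<Rightarrow> complex \<Rightarrow> complex" where
  "recip_F \<mu> z = 1 / cauchy_G \<mu> z"

definition trunc_cone :: "real \<Rightarrow> real \<Rightarrow> complex set" where
  "trunc_cone \<alpha> \<beta> = {z. Im z > 0 \<and> Im z > \<beta> \<and> \<bar>Re z\<bar> < \<alpha> * Im z}"

definition cone_domain :: "complex set \<Rightarrow> bool" where
  "cone_domain \<Omega> \<longleftrightarrow>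
     (\<exists>b :: real \<Rightarrow> real. (\<forall>\<alpha>>0. b \<alpha> > 0) \<and> \<Omega> = (\<Union>\<alpha>\<in>{0<..}. trunc_cone \<alpha> (b \<alpha>)))"

text \<open>
  In the asymptotic condition the filter restricts to the truncated cone only, not to its
  intersection with \<open>\<Omega>\<close>: each truncated cone lies in \<open>\<Omega>\<close> up to a bounded set, so the
  values of \<open>g\<close> outside \<open>\<Omega>\<close> do not matter.
\<close>
definition F_right_inverse_on :: "real measure \<Rightarrow> complex set \<Rightarrow> (complex \<Rightarrow> complex) \<Rightarrow> bool" where
  "F_right_inverse_on \<mu> \<Omega> g \<longleftrightarrow>
     g holomorphic_on \<Omega> \<and>
     (\<forall>z\<in>\<Omega>. g z \<in> upper_half_plane \<and> recip_F \<mu> (g z) = z) \<and>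
     (\<forall>\<alpha>>0. \<forall>\<beta>>0. ((\<lambda>z. g z / z) \<longlongrightarrow> 1) (inf at_infinity (principal (trunc_cone \<alpha> \<beta>))))"

text \<open>
  The domain of the transform is not canonical, so it is a relation: \<open>\<phi>\<close> is a version of the
  transform of \<open>\<mu>\<close> on the domain \<open>\<Omega>\<close>.  Such a version always exists
  (\<open>voiculescu_transform_exists\<close> below).
\<close>
definition voiculescu_transform_on ::
    "real measure \<Rightarrow> complex set \<Rightarrow> (complex \<Rightarrow> complex) \<Rightarrow> bool" where
  "voiculescu_transform_on \<mu> \<Omega> \<phi> \<longleftrightarrow>
     cone_domain \<Omega> \<and> (\<exists>g. F_right_inverse_on \<mu> \<Omega> g \<and> (\<forall>z\<in>\<Omega>. \<phi> z = g z - z))"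

definition H_map :: "real \<Rightarrow> real measure \<Rightarrow> complex \<Rightarrow> complex" where
  "H_map t \<mu> z = of_real t * z + (1 - of_real t) * recip_F \<mu> z"


lemma cauchy_kernel_bound:
  assumes "Im z > 0"
  shows "norm (1 / (z - of_real x)) \<le> 1 / Im z"
proof -
  have "Im z \<le> norm (z - of_real x)"
    using abs_Im_le_cmod[of "z - of_real x"] by simp
  then show ?thesis using assms by (simp add: norm_divide frac_le)
qed

lemma cauchy_kernel_nz: "Im z > 0 \<Longrightarrow> z - of_real x \<noteq> 0"
  by (auto simp: complex_eq_iff)

lemma trunc_cone_norm:
  assumes "z \<in> trunc_cone \<alpha> \<beta>"
  shows "norm z \<le> (1 + \<alpha>) * Im z"
proof -
  have "norm z \<le> \<bar>Re z\<bar> + \<bar>Im z\<bar>" by (rule cmod_le)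
  also have "\<dots> \<le> (1 + \<alpha>) * Im z" using assms by (auto simp: trunc_cone_def algebra_simps)
  finally show ?thesis .
qed

lemma open_trunc_cone: "open (trunc_cone \<alpha> \<beta>)"
  unfolding trunc_cone_def
  by (intro open_Collect_conj open_Collect_less continuous_intros)

lemma convex_trunc_cone: "convex (trunc_cone \<alpha> \<beta>)"
proof -
  have "trunc_cone \<alpha> \<beta> = {z. Im z > 0} \<inter> {z. Im z > \<beta>} \<inter>
      {z. inner (Complex 1 (-\<alpha>)) z < 0} \<inter> {z. inner (Complex (-1) (-\<alpha>)) z < 0}"
    by (auto simp: trunc_cone_def inner_complex_def)
  then show ?thesis
    by (auto intro!: convex_Int convex_halfspace_lt convex_halfspace_Im_gt)
qed

lemma trunc_cone_cball:
  assumes "z \<in> trunc_cone \<alpha> (2 * \<beta>)" "\<alpha> > 0" "\<beta> > 0" "norm (w - z) \<le> Im z / 2"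
  shows "w \<in> trunc_cone (2 * \<alpha> + 1) \<beta>"
proof -
  have 1: "\<bar>Re w - Re z\<bar> \<le> Im z / 2" "\<bar>Im w - Im z\<bar> \<le> Im z / 2"
    using abs_Re_le_cmod[of "w - z"] abs_Im_le_cmod[of "w - z"] assms(4) by auto
  have z: "Im z > 0" "Im z > 2 * \<beta>" "\<bar>Re z\<bar> < \<alpha> * Im z"
    using assms(1) by (auto simp: trunc_cone_def)
  have i: "Im w \<ge> Im z / 2" using 1 by linarith
  have "\<bar>Re w\<bar> < \<alpha> * Im z + Im z / 2" using 1 z by linarith
  also have "\<dots> = (2 * \<alpha> + 1) * (Im z / 2)" by (simp add: algebra_simps)
  also have "\<dots> \<le> (2 * \<alpha> + 1) * Im w" using i assms by (intro mult_left_mono) auto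
  finally show ?thesis using i z by (auto simp: trunc_cone_def)
qed

context real_distribution
begin

lemma integrable_cauchy_kernel:
  assumes "Im z > 0"
  shows "integrable M (\<lambda>x. 1 / (z - of_real x) :: complex)"
  by (rule integrable_const_bound[where B = "1 / Im z"])
     (use cauchy_kernel_bound[OF assms] in auto)

lemma cauchy_G_has_field_derivative:
  assumes z: "Im z > 0"
  shows "(cauchy_G M has_field_derivative (\<integral>x. - 1 / (z - of_real x)^2 \<partial>M)) (at z)"
  unfolding has_field_derivative_iff tendsto_at_iff_sequentially
proof (intro allI impI)
  fix X :: "nat \<Rightarrow> complex"
  assume X: "\<forall>i. X i \<in> UNIV - {z}" and lim: "X \<longlonglongrightarrow> z"
  have "(\<lambda>i. Im (X i)) \<longlonglongrightarrow> Im z" by (intro tendsto_intros lim)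
  then have "eventually (\<lambda>i. Im (X i) > Im z / 2) sequentially"
    using z by (intro order_tendstoD(1)) auto
  then obtain N where N: "\<And>i. i \<ge> N \<Longrightarrow> Im (X i) > Im z / 2"
    unfolding eventually_sequentially by blast
  define Y where "Y i = X (i + N)" for i
  have Y: "Im (Y i) > Im z / 2" "Im (Y i) > 0" "Y i \<noteq> z" for i
    using N[of "i + N"] X z by (auto simp: Y_def intro: less_trans[of 0 "Im z / 2"])
  have limY: "Y \<longlonglongrightarrow> z" unfolding Y_def by (rule LIMSEQ_ignore_initial_segment[OF lim])
  have eq: "(cauchy_G M (Y i) - cauchy_G M z) / (Y i - z) =
      (\<integral>x. - (1 / (Y i - of_real x)) * (1 / (z - of_real x)) \<partial>M)" for i
  proof -
    have "cauchy_G M (Y i) - cauchy_G M z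
        = (\<integral>x. 1 / (Y i - of_real x) - 1 / (z - of_real x) \<partial>M)"
      unfolding cauchy_G_def
      by (rule Bochner_Integration.integral_diff[symmetric])
         (intro integrable_cauchy_kernel z Y)+
    also have "\<dots> = (\<integral>x. (Y i - z) * (- (1 / (Y i - of_real x)) * (1 / (z - of_real x))) \<partial>M)"
    proof (rule Bochner_Integration.integral_cong[OF refl])
      fix x
      show "1 / (Y i - of_real x) - 1 / (z - of_real x)
          = (Y i - z) * (- (1 / (Y i - of_real x)) * (1 / (z - of_real x)))"
        using cauchy_kernel_nz[OF Y(2)[of i], of x] cauchy_kernel_nz[OF z, of x]
        by (simp add: divide_simps)
    qed
    also have "\<dots> = (Y i - z) * (\<integral>x. - (1 / (Y i - of_real x)) * (1 / (z - of_real x)) \<partial>M)"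
      by (rule integral_mult_right_zero)
    finally show ?thesis using Y(3)[of i] by (simp add: divide_simps)
  qed
  have "(\<lambda>i. \<integral>x. - (1 / (Y i - of_real x)) * (1 / (z - of_real x)) \<partial>M)
      \<longlonglongrightarrow> (\<integral>x. - 1 / (z - of_real x)^2 \<partial>M)"
  proof (rule integral_dominated_convergence[where w = "\<lambda>_. (2 / Im z) * (1 / Im z)"])
    show "AE x in M. (\<lambda>i. - (1 / (Y i - of_real x)) * (1 / (z - of_real x)))
        \<longlonglongrightarrow> - 1 / (z - complex_of_real x)^2"
    proof (rule AE_I2)
      fix x
      have "(\<lambda>i. - (1 / (Y i - of_real x)) * (1 / (z - of_real x)))
        \<longlonglongrightarrow> - (1 / (z - of_real x)) * (1 / (z - of_real x))"
        by (intro tendsto_intros limY cauchy_kernel_nz z)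
      then show "(\<lambda>i. - (1 / (Y i - of_real x)) * (1 / (z - of_real x)))
        \<longlonglongrightarrow> - 1 / (z - complex_of_real x)^2"
        by (simp add: power2_eq_square)
    qed
    show "AE x in M. norm (- (1 / (Y i - complex_of_real x)) * (1 / (z - of_real x)))
        \<le> (2 / Im z) * (1 / Im z)" for i
    proof (rule AE_I2)
      fix x
      have "norm (1 / (Y i - complex_of_real x)) \<le> 1 / Im (Y i)"
        by (rule cauchy_kernel_bound[OF Y(2)])
      also have "\<dots> \<le> 1 / (Im z / 2)"
        using Y(1)[of i] z by (intro divide_left_mono) auto
      finally have "norm (1 / (Y i - complex_of_real x)) \<le> 2 / Im z" by simp
      then show "norm (- (1 / (Y i - complex_of_real x)) * (1 / (z - of_real x)))
        \<le> (2 / Im z) * (1 / Im z)"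
        using cauchy_kernel_bound[OF z, of x] z unfolding norm_mult norm_minus_cancel
        by (intro mult_mono) auto
    qed
  qed (auto)
  then have "(\<lambda>i. (cauchy_G M (Y i) - cauchy_G M z) / (Y i - z))
      \<longlonglongrightarrow> (\<integral>x. - 1 / (z - of_real x)^2 \<partial>M)"
    by (simp only: eq)
  then show "((\<lambda>w. (cauchy_G M w - cauchy_G M z) / (w - z)) \<circ> X)
      \<longlonglongrightarrow> (\<integral>x. - 1 / (z - of_real x)^2 \<partial>M)"
    unfolding Y_def comp_def by (rule LIMSEQ_offset)
qed

lemma cauchy_G_asymp:
  assumes "\<alpha> > 0" "\<epsilon> > 0"
  shows "\<exists>\<beta>>0. \<forall>z\<in>trunc_cone \<alpha> \<beta>. norm (z * cauchy_G M z - 1) < \<epsilon>"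
proof (rule ccontr)
  assume *: "\<not> ?thesis"
  have "\<exists>z\<in>trunc_cone \<alpha> (real (Suc n)). \<epsilon> \<le> norm (z * cauchy_G M z - 1)" for n
    using * by (auto simp: not_less dest!: spec[of _ "real (Suc n)"])
  then obtain Z where Z: "\<And>n. Z n \<in> trunc_cone \<alpha> (real (Suc n))"
    and far: "\<And>n. \<epsilon> \<le> norm (Z n * cauchy_G M (Z n) - 1)"
    by metis
  have Zp: "Im (Z n) > 0" "Im (Z n) > real (Suc n)" for n
    using Z[of n] by (auto simp: trunc_cone_def)
  have Zinf: "filterlim Z at_infinity sequentially"
  proof (rule filterlim_norm_at_top_imp_at_infinity)
    show "filterlim (\<lambda>n. norm (Z n)) at_top sequentially"
    proof (rule filterlim_at_top_mono[OF filterlim_real_sequentially], rule always_eventually, rule allI)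
      fix n show "real n \<le> norm (Z n)"
        using Zp(2)[of n] abs_Im_le_cmod[of "Z n"] by linarith
    qed
  qed
  have "(\<lambda>n. \<integral>x. Z n * (1 / (Z n - of_real x)) \<partial>M) \<longlonglongrightarrow> (\<integral>x. (1::complex) \<partial>M)"
  proof (rule integral_dominated_convergence[where w = "\<lambda>_. 1 + \<alpha>"])
    show "AE x in M. (\<lambda>n. Z n * (1 / (Z n - of_real x))) \<longlonglongrightarrow> 1"
    proof (rule AE_I2)
      fix x :: real
      have "(\<lambda>n. 1 / (1 - of_real x * inverse (Z n))) \<longlonglongrightarrow> 1 / (1 - of_real x * 0)"
        by (intro tendsto_intros filterlim_compose[OF tendsto_inverse_0 Zinf]) auto
      moreover have "1 / (1 - of_real x * inverse (Z n)) = Z n * (1 / (Z n - of_real x))" for n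
      proof -
        have "Z n \<noteq> 0" using Zp(1)[of n] by auto
        then show ?thesis using cauchy_kernel_nz[OF Zp(1)[of n], of x]
          by (simp add: divide_simps)
      qed
      ultimately show "(\<lambda>n. Z n * (1 / (Z n - of_real x))) \<longlonglongrightarrow> 1" by simp
    qed
    show "AE x in M. norm (Z n * (1 / (Z n - complex_of_real x))) \<le> 1 + \<alpha>" for n
    proof (rule AE_I2)
      fix x :: real
      have "norm (Z n * (1 / (Z n - complex_of_real x))) \<le> ((1 + \<alpha>) * Im (Z n)) * (1 / Im (Z n))"
        unfolding norm_mult
        by (intro mult_mono trunc_cone_norm[OF Z] cauchy_kernel_bound Zp) (use assms Zp(1)[of n] in auto)
      also have "\<dots> = 1 + \<alpha>" using Zp(1)[of n] by simp
      finally show "norm (Z n * (1 / (Z n - complex_of_real x))) \<le> 1 + \<alpha>" .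
    qed
  qed auto
  then have "(\<lambda>n. Z n * cauchy_G M (Z n)) \<longlonglongrightarrow> 1"
    by (simp only: integral_mult_right_zero cauchy_G_def) (simp add: prob_space[unfolded space_eq_univ])
  then have "eventually (\<lambda>n. norm (Z n * cauchy_G M (Z n) - 1) < \<epsilon>) sequentially"
    using assms(2) unfolding tendsto_iff dist_norm by blast
  then show False using far by (auto simp: not_less[symmetric] eventually_sequentially)
qed

lemma recip_F_asymp:
  assumes "\<alpha> > 0" "\<epsilon> > 0"
  shows "\<exists>\<beta>>0. recip_F M holomorphic_on trunc_cone \<alpha> \<beta> \<and>
           (\<forall>z\<in>trunc_cone \<alpha> \<beta>. norm (recip_F M z - z) \<le> \<epsilon> * norm z)"
proof -
  define d where "d = min (1/2) (\<epsilon> / 2)"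
  have d: "d > 0" "d \<le> 1/2" "d \<le> \<epsilon> / 2" using assms by (auto simp: d_def)
  obtain \<beta> where b: "\<beta> > 0" and B: "\<And>z. z \<in> trunc_cone \<alpha> \<beta> \<Longrightarrow> norm (z * cauchy_G M z - 1) < d"
    using cauchy_G_asymp[OF assms(1) d(1)] by blast
  have nz: "cauchy_G M z \<noteq> 0" if "z \<in> trunc_cone \<alpha> \<beta>" for z
    using B[OF that] d by auto
  have "cauchy_G M holomorphic_on trunc_cone \<alpha> \<beta>"
    unfolding holomorphic_on_open[OF open_trunc_cone]
    using cauchy_G_has_field_derivative by (auto simp: trunc_cone_def)
  then have "recip_F M holomorphic_on trunc_cone \<alpha> \<beta>"
    unfolding recip_F_def using nz by (intro holomorphic_intros) auto
  moreover have "norm (recip_F M z - z) \<le> \<epsilon> * norm z" if z: "z \<in> trunc_cone \<alpha> \<beta>" for z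
  proof -
    define w where "w = z * cauchy_G M z"
    have w: "norm (w - 1) < d" using B[OF z] by (simp add: w_def)
    have w2: "norm w \<ge> 1/2" using norm_triangle_ineq2[of 1 "1 - w"] w d by (simp add: norm_minus_commute)
    have z0: "z \<noteq> 0" using z by (auto simp: trunc_cone_def)
    then have "w \<noteq> 0" using nz[OF z] by (simp add: w_def)
    then have "recip_F M z - z = z * ((1 - w) / w)"
      using z0 nz[OF z] by (simp add: recip_F_def w_def field_simps)
    then have "norm (recip_F M z - z) = norm z * (norm (w - 1) / norm w)"
      by (simp add: norm_mult norm_divide norm_minus_commute)
    also have "\<dots> \<le> norm z * (d / (1/2))"
      using w w2 d by (intro mult_left_mono frac_le) auto
    also have "\<dots> \<le> norm z * \<epsilon>" using d by (intro mult_left_mono) auto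
    finally show ?thesis by (simp add: mult.commute)
  qed
  ultimately show ?thesis using b by blast
qed

lemma recip_F_inj:
  assumes "\<alpha> > 0"
  shows "\<exists>\<beta>>0. recip_F M holomorphic_on trunc_cone \<alpha> \<beta> \<and> inj_on (recip_F M) (trunc_cone \<alpha> \<beta>)"
proof -
  define \<alpha>' where "\<alpha>' = 2 * \<alpha> + 1"
  define \<epsilon> where "\<epsilon> = 1 / (6 * (1 + \<alpha>'))"
  have p: "\<alpha>' > 0" "\<epsilon> > 0" using assms by (auto simp: \<alpha>'_def \<epsilon>_def)
  obtain \<beta> where b: "\<beta> > 0" and hol: "recip_F M holomorphic_on trunc_cone \<alpha>' \<beta>"
    and bd: "\<And>z. z \<in> trunc_cone \<alpha>' \<beta> \<Longrightarrow> norm (recip_F M z - z) \<le> \<epsilon> * norm z"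
    using recip_F_asymp[OF p] by blast
  define h where "h z = recip_F M z - z" for z
  have holh: "h holomorphic_on trunc_cone \<alpha>' \<beta>"
    unfolding h_def by (intro holomorphic_intros hol)
  have sub: "cball z (Im z / 2) \<subseteq> trunc_cone \<alpha>' \<beta>" if "z \<in> trunc_cone \<alpha> (2 * \<beta>)" for z
    using trunc_cone_cball[OF that assms b] by (auto simp: \<alpha>'_def dist_norm norm_minus_commute)
  have "trunc_cone \<alpha> (2 * \<beta>) \<subseteq> trunc_cone \<alpha>' \<beta>"
  proof
    fix z assume z: "z \<in> trunc_cone \<alpha> (2 * \<beta>)"
    then have "z \<in> cball z (Im z / 2)" by (auto simp: trunc_cone_def)
    then show "z \<in> trunc_cone \<alpha>' \<beta>" using sub[OF z] by blast
  qed
  note holh' = holomorphic_on_subset[OF holh this] and hol' = holomorphic_on_subset[OF hol this]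
  have dh: "norm (deriv h z) \<le> 1/2" if z: "z \<in> trunc_cone \<alpha> (2 * \<beta>)" for z
  proof -
    have zp: "Im z > 0" using z by (auto simp: trunc_cone_def)
    have "norm ((deriv ^^ 1) h z) \<le> fact 1 * (Im z / 4) / (Im z / 2) ^ 1"
    proof (rule Cauchy_inequality)
      show "h holomorphic_on ball z (Im z / 2)"
        by (rule holomorphic_on_subset[OF holh]) (use sub[OF z] ball_subset_cball in blast)
      show "continuous_on (cball z (Im z / 2)) h"
        by (rule holomorphic_on_imp_continuous_on, rule holomorphic_on_subset[OF holh sub[OF z]])
      fix w assume w: "norm (z - w) = Im z / 2"
      then have wc: "w \<in> trunc_cone \<alpha>' \<beta>" using sub[OF z] by (auto simp: dist_norm)
      have "norm (h w) \<le> \<epsilon> * norm w" using bd[OF wc] by (simp add: h_def)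
      also have "\<dots> \<le> \<epsilon> * ((1 + \<alpha>') * Im w)"
        using trunc_cone_norm[OF wc] p by (intro mult_left_mono) auto
      also have "\<dots> = Im w / 6" using p by (simp add: \<epsilon>_def field_simps)
      also have "\<dots> \<le> Im z / 4"
      proof -
        have "\<bar>Im z - Im w\<bar> \<le> Im z / 2" using abs_Im_le_cmod[of "z - w"] w by simp
        then show ?thesis by linarith
      qed
      finally show "norm (h w) \<le> Im z / 4" .
    qed (use zp in auto)
    then show ?thesis using zp by simp
  qed
  have "inj_on (recip_F M) (trunc_cone \<alpha> (2 * \<beta>))"
  proof (rule inj_onI)
    fix x y assume x: "x \<in> trunc_cone \<alpha> (2 * \<beta>)" and y: "y \<in> trunc_cone \<alpha> (2 * \<beta>)"
      and eq: "recip_F M x = recip_F M y"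
    have "norm (h x - h y) \<le> 1/2 * norm (x - y)"
    proof (rule field_differentiable_bound[OF convex_trunc_cone _ dh x y])
      fix z assume "z \<in> trunc_cone \<alpha> (2 * \<beta>)"
      then show "(h has_field_derivative deriv h z) (at z within trunc_cone \<alpha> (2 * \<beta>))"
        using holomorphic_derivI[OF holh' open_trunc_cone] by blast
    qed
    moreover have "h x - h y = y - x" using eq by (simp add: h_def)
    ultimately show "x = y" by (simp add: norm_minus_commute)
  qed
  then show ?thesis using hol' b by (intro exI[of _ "2 * \<beta>"]) auto
qed

lemma trunc_cone_mono:
  "\<alpha> \<le> \<alpha>' \<Longrightarrow> \<beta>' \<le> \<beta> \<Longrightarrow> trunc_cone \<alpha> \<beta> \<subseteq> trunc_cone \<alpha>' \<beta>'"
  by (auto simp: trunc_cone_def intro: less_le_trans mult_right_mono)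

lemma recip_F_local_inverse:
  assumes "\<alpha> > 0"
  shows "\<exists>\<beta>>0. recip_F M holomorphic_on trunc_cone (2 * \<alpha> + 1) \<beta> \<and>
           inj_on (recip_F M) (trunc_cone (2 * \<alpha> + 1) \<beta>) \<and>
           (\<forall>z\<in>trunc_cone \<alpha> (2 * \<beta>). \<exists>w\<in>cball z (Im z / 2). recip_F M w = z)"
proof -
  define \<alpha>' where "\<alpha>' = 2 * \<alpha> + 1"
  define \<epsilon> where "\<epsilon> = 1 / (6 * (1 + \<alpha>'))"
  have p: "\<alpha>' > 0" "\<epsilon> > 0" using assms by (auto simp: \<alpha>'_def \<epsilon>_def)
  obtain b1 where b1: "b1 > 0"
    and bd: "\<And>z. z \<in> trunc_cone \<alpha>' b1 \<Longrightarrow> norm (recip_F M z - z) \<le> \<epsilon> * norm z"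
    using recip_F_asymp[OF p] by blast
  obtain b2 where b2: "b2 > 0" and hol: "recip_F M holomorphic_on trunc_cone \<alpha>' b2"
    and inj: "inj_on (recip_F M) (trunc_cone \<alpha>' b2)"
    using recip_F_inj[OF p(1)] by blast
  define \<beta> where "\<beta> = max b1 b2"
  have b: "\<beta> > 0" using b1 by (auto simp: \<beta>_def)
  have s1: "trunc_cone \<alpha>' \<beta> \<subseteq> trunc_cone \<alpha>' b1" and s2: "trunc_cone \<alpha>' \<beta> \<subseteq> trunc_cone \<alpha>' b2"
    by (intro trunc_cone_mono; simp add: \<beta>_def)+
  have hol': "recip_F M holomorphic_on trunc_cone \<alpha>' \<beta>"
    by (rule holomorphic_on_subset[OF hol s2])
  have "\<exists>w\<in>cball z (Im z / 2). recip_F M w = z" if z: "z \<in> trunc_cone \<alpha> (2 * \<beta>)" for z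
  proof -
    have zp: "Im z > 0" using z by (auto simp: trunc_cone_def)
    have sub: "cball z (Im z / 2) \<subseteq> trunc_cone \<alpha>' \<beta>"
      using trunc_cone_cball[OF z assms b] by (auto simp: \<alpha>'_def dist_norm norm_minus_commute)
    obtain w where w: "w \<in> cball z (Im z / 2)" "w - recip_F M w + z = w"
    proof (rule brouwer_ball)
      show "Im z / 2 > 0" using zp by simp
      show "continuous_on (cball z (Im z / 2)) (\<lambda>w. w - recip_F M w + z)"
        by (intro continuous_intros holomorphic_on_imp_continuous_on holomorphic_on_subset[OF hol' sub])
      show "(\<lambda>w. w - recip_F M w + z) \<in> cball z (Im z / 2) \<rightarrow> cball z (Im z / 2)"
      proof (rule Pi_I)
        fix w assume w: "w \<in> cball z (Im z / 2)"
        then have wc: "w \<in> trunc_cone \<alpha>' \<beta>" using sub by blast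
        have "norm (recip_F M w - w) \<le> \<epsilon> * norm w" using bd wc s1 by blast
        also have "\<dots> \<le> \<epsilon> * ((1 + \<alpha>') * Im w)"
          using trunc_cone_norm[OF wc] p by (intro mult_left_mono) auto
        also have "\<dots> = Im w / 6" using p by (simp add: \<epsilon>_def field_simps)
        also have "\<dots> \<le> Im z / 2"
          using abs_Im_le_cmod[of "z - w"] w zp by (auto simp: dist_norm)
        finally show "w - recip_F M w + z \<in> cball z (Im z / 2)"
          by (simp add: dist_norm)
      qed
    qed (use that in blast)
    then show ?thesis by (intro bexI[of _ w]) (auto simp: algebra_simps)
  qed
  moreover have "inj_on (recip_F M) (trunc_cone \<alpha>' \<beta>)" by (rule inj_on_subset[OF inj s2])
  ultimately show ?thesis using b hol' unfolding \<alpha>'_def by blast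
qed

lemma voiculescu_transform_exists: "\<exists>\<Omega> \<phi>. voiculescu_transform_on M \<Omega> \<phi>"
proof -
  obtain b where b: "\<And>\<alpha>. \<alpha> > 0 \<Longrightarrow> b \<alpha> > 0"
    and hol: "\<And>\<alpha>. \<alpha> > 0 \<Longrightarrow> recip_F M holomorphic_on trunc_cone (2 * \<alpha> + 1) (b \<alpha>)"
    and inj: "\<And>\<alpha>. \<alpha> > 0 \<Longrightarrow> inj_on (recip_F M) (trunc_cone (2 * \<alpha> + 1) (b \<alpha>))"
    and ex: "\<And>\<alpha> z. \<alpha> > 0 \<Longrightarrow> z \<in> trunc_cone \<alpha> (2 * b \<alpha>) \<Longrightarrow>
               \<exists>w\<in>cball z (Im z / 2). recip_F M w = z"
    using recip_F_local_inverse by metis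
  define \<Omega> where "\<Omega> = (\<Union>\<alpha>\<in>{0<..}. trunc_cone \<alpha> (2 * b \<alpha>))"
  have dom: "cone_domain \<Omega>"
    unfolding cone_domain_def \<Omega>_def using b by (intro exI[of _ "\<lambda>\<alpha>. 2 * b \<alpha>"]) auto
  define g where "g z = (SOME w. w \<in> cball z (Im z / 2) \<and> recip_F M w = z)" for z
  have g: "g z \<in> cball z (Im z / 2)" "recip_F M (g z) = z"
    if "\<alpha> > 0" "z \<in> trunc_cone \<alpha> (2 * b \<alpha>)" for \<alpha> z
  proof -
    have "\<exists>w. w \<in> cball z (Im z / 2) \<and> recip_F M w = z" using ex[OF that] by blast
    from someI_ex[OF this] show "g z \<in> cball z (Im z / 2)" "recip_F M (g z) = z"
      by (auto simp: g_def)
  qed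
  have gc: "g z \<in> trunc_cone (2 * \<alpha> + 1) (b \<alpha>)" if "\<alpha> > 0" "z \<in> trunc_cone \<alpha> (2 * b \<alpha>)" for \<alpha> z
    using trunc_cone_cball[OF that(2,1) b[OF that(1)]] g(1)[OF that]
    by (auto simp: dist_norm norm_minus_commute)
  have holg: "g holomorphic_on trunc_cone \<alpha> (2 * b \<alpha>)" if a: "\<alpha> > 0" for \<alpha>
  proof -
    obtain k where k: "k holomorphic_on recip_F M ` trunc_cone (2 * \<alpha> + 1) (b \<alpha>)"
      and kF: "\<And>w. w \<in> trunc_cone (2 * \<alpha> + 1) (b \<alpha>) \<Longrightarrow> k (recip_F M w) = w"
      using holomorphic_has_inverse[OF hol[OF a] open_trunc_cone inj[OF a]] by metis
    have "k z = g z" if "z \<in> trunc_cone \<alpha> (2 * b \<alpha>)" for z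
      using kF[OF gc[OF a that]] g(2)[OF a that] by simp
    moreover have "k holomorphic_on trunc_cone \<alpha> (2 * b \<alpha>)"
      by (rule holomorphic_on_subset[OF k]) (use gc[OF a] g(2)[OF a] in \<open>force simp: image_iff\<close>)
    ultimately show ?thesis using holomorphic_transform by blast
  qed
  have "g holomorphic_on \<Omega>"
    unfolding \<Omega>_def by (intro holomorphic_on_UN_open open_trunc_cone holg) auto
  moreover have "g z \<in> upper_half_plane \<and> recip_F M (g z) = z" if "z \<in> \<Omega>" for z
    using that g(2) gc by (fastforce simp: \<Omega>_def upper_half_plane_def trunc_cone_def)
  moreover have "((\<lambda>z. g z / z) \<longlongrightarrow> 1) (inf at_infinity (principal (trunc_cone \<alpha> \<beta>)))"
    if a: "\<alpha> > 0" for \<alpha> \<beta>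
  proof (rule tendstoI)
    fix e :: real assume e: "e > 0"
    obtain c where c: "c > 0"
      and cb: "\<And>w. w \<in> trunc_cone (2 * \<alpha> + 1) c \<Longrightarrow> norm (recip_F M w - w) \<le> e / 4 * norm w"
      using recip_F_asymp[of "2 * \<alpha> + 1" "e / 4"] a e by auto
    define R where "R = (1 + \<alpha>) * (2 * max (b \<alpha>) c + 1)"
    have "dist (g z / z) 1 < e" if zR: "norm z \<ge> R" and z: "z \<in> trunc_cone \<alpha> \<beta>" for z
    proof -
      have "(1 + \<alpha>) * (2 * max (b \<alpha>) c + 1) \<le> (1 + \<alpha>) * Im z"
        using trunc_cone_norm[OF z] zR by (simp add: R_def)
      then have "2 * max (b \<alpha>) c + 1 \<le> Im z" using a by simp
      then have Im: "Im z > 2 * b \<alpha>" "Im z > 2 * c" by auto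
      then have z1: "z \<in> trunc_cone \<alpha> (2 * b \<alpha>)" and z2: "z \<in> trunc_cone \<alpha> (2 * c)"
        using z by (auto simp: trunc_cone_def)
      have z0: "z \<noteq> 0" and zp: "Im z > 0" using z by (auto simp: trunc_cone_def)
      have gb: "norm (g z - z) \<le> Im z / 2"
        using g(1)[OF a z1] by (simp add: dist_norm norm_minus_commute)
      then have "norm (g z - z) \<le> norm z" using abs_Im_le_cmod[of z] zp by linarith
      then have g2: "norm (g z) \<le> 2 * norm z" using norm_triangle_ineq2[of "g z" z] by linarith
      have "g z \<in> trunc_cone (2 * \<alpha> + 1) c" by (rule trunc_cone_cball[OF z2 a c gb])
      from cb[OF this] have "norm (g z - z) \<le> e / 4 * norm (g z)"
        using g(2)[OF a z1] by (simp add: norm_minus_commute)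
      also have "\<dots> \<le> e / 4 * (2 * norm z)" using g2 e by (intro mult_left_mono) auto
      also have "\<dots> < e * norm z" using e z0 by simp
      finally have "norm (g z - z) < e * norm z" .
      moreover have "dist (g z / z) 1 = norm (g z - z) / norm z"
        using z0 by (simp add: dist_norm divide_simps flip: norm_divide)
      ultimately show ?thesis using z0 by (simp add: pos_divide_less_eq)
    qed
    then show "eventually (\<lambda>z. dist (g z / z) 1 < e) (inf at_infinity (principal (trunc_cone \<alpha> \<beta>)))"
      unfolding eventually_inf_principal eventually_at_infinity by blast
  qed
  ultimately have "F_right_inverse_on M \<Omega> g" by (auto simp: F_right_inverse_on_def)
  then have "voiculescu_transform_on M \<Omega> (\<lambda>z. g z - z)"
    using dom by (auto simp: voiculescu_transform_on_def)
  then show ?thesis by blast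
qed

end

end

theory Submission
  imports Defs
begin

text \<open>
  Write \<open>F = F_\<mu>\<close>, \<open>h = F - id\<close> and \<open>s = t - 1\<close>, so that \<open>H_t(w) = w - s h(w)\<close> with \<open>Im h \<ge> 0\<close> on
  the upper half-plane. By the Schwarz--Pick inequality for \<open>h\<close>, \<open>H_t\<close> is injective and proper from
  \<open>{w. Im w > 0 \<and> Im (H_t w) > 0}\<close> to the upper half-plane; its image is therefore open, closed
  and, by Brouwer's theorem near infinity, nonempty, hence everything. Its inverse is \<open>\<omega>_t\<close>. As
  \<open>Im (F(\<omega>_t(z))) \<ge> Im z\<close> and \<open>F(\<omega>_t(i y)) / (i y) \<rightarrow> 1\<close>, the function \<open>1 / (F \<circ> \<omega>_t)\<close> is the
  Cauchy transform of a probability measure \<open>\<mu>_t\<close>. Far out in a cone, \<open>\<omega>_t\<close> applied to the inverse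
  of \<open>F_{\<mu>_t}\<close> must be the inverse of \<open>F\<close> by injectivity of \<open>F\<close> there, which is the relation between
  the transforms; the identity theorem extends it to the common domain.
\<close>

section \<open>The Poisson formula for the upper half-plane\<close>

text \<open>\<open>arctan ((x - u) / y) / y\<close> is an antiderivative of the kernel; as the
  integrand is nonnegative, its limits at both ends give integrability and the value
  together.\<close>

lemma
  fixes u y :: real
  assumes y: "y > 0"
  shows integrable_poisson_kernel: "integrable lborel (\<lambda>x. 1 / ((x - u)\<^sup>2 + y\<^sup>2))"
    and integral_poisson_kernel: "(\<integral>x. 1 / ((x - u)\<^sup>2 + y\<^sup>2) \<partial>lborel) = pi / y"
proof -
  let ?f = "\<lambda>x. 1 / ((x - u)\<^sup>2 + y\<^sup>2)" and ?F = "\<lambda>x. arctan ((x - u) / y) / y"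
  have pos: "(x - u)\<^sup>2 + y\<^sup>2 > 0" for x
    using y by (intro add_nonneg_pos) auto
  have der: "(?F has_real_derivative ?f x) (at x)" for x
  proof -
    have "1 + ((x - u) / y)\<^sup>2 = ((x - u)\<^sup>2 + y\<^sup>2) / y\<^sup>2"
      using y by (simp add: field_simps)
    then have "inverse (1 + ((x - u) / y)\<^sup>2) * (1 / y) / y = ?f x"
      using y by (simp add: power2_eq_square)
    moreover have "(?F has_real_derivative inverse (1 + ((x - u) / y)\<^sup>2) * (1 / y) / y) (at x)"
      using y by (auto intro!: derivative_eq_intros)
    ultimately show ?thesis by simp
  qed
  have top: "filterlim (\<lambda>x. (x - u) / y) at_top at_top" and bot: "filterlim (\<lambda>x. (x - u) / y) at_bot at_bot"
    using y by real_asymp+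
  have 1: "((?F \<circ> real_of_ereal) \<longlongrightarrow> (- (pi/2)) / y) (at_right (-\<infinity>))"
    unfolding ereal_tendsto_simps
    by (intro tendsto_intros filterlim_compose[OF tendsto_arctan_at_bot bot]) (use y in auto)
  have 2: "((?F \<circ> real_of_ereal) \<longlongrightarrow> (pi/2) / y) (at_left \<infinity>)"
    unfolding ereal_tendsto_simps
    by (intro tendsto_intros filterlim_compose[OF tendsto_arctan_at_top top]) (use y in auto)
  have cont: "isCont ?f x" for x
    using pos[of x] by (intro continuous_intros) auto
  have *: "set_integrable lborel (einterval (-\<infinity>) \<infinity>) ?f"
    "(LBINT x=-\<infinity>..\<infinity>. ?f x) = (pi/2) / y - (- (pi/2)) / y"
    by (rule interval_integral_FTC_nonneg[where F = ?F]; use 1 2 der cont pos less_imp_le in auto)+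
  show "integrable lborel ?f"
    using *(1) by (simp add: set_integrable_def einterval_def)
  show "(\<integral>x. ?f x \<partial>lborel) = pi / y"
    using *(2) y by (simp add: interval_lebesgue_integral_def set_lebesgue_integral_def einterval_def field_simps)
qed

lemma integrable_poisson_bounded:
  fixes g :: "real \<Rightarrow> complex"
  assumes "Im z > 0" "g \<in> borel_measurable borel" "\<And>x. norm (g x) \<le> B"
  shows "integrable lborel (\<lambda>x. g x / of_real ((x - Re z)\<^sup>2 + (Im z)\<^sup>2))"
proof (rule Bochner_Integration.integrable_bound)
  show "integrable lborel (\<lambda>x. B * (1 / ((x - Re z)\<^sup>2 + (Im z)\<^sup>2)))"
    using integrable_poisson_kernel[OF assms(1)] by (rule integrable_mult_right)
  have "norm (g x / of_real ((x - Re z)\<^sup>2 + (Im z)\<^sup>2)) \<le> B * (1 / ((x - Re z)\<^sup>2 + (Im z)\<^sup>2))" for x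
    unfolding norm_divide norm_of_real
    using assms(3)[of x] by (auto intro!: divide_right_mono)
  moreover have "B \<ge> 0" using assms(3)[of 0] norm_ge_zero order_trans by blast
  ultimately show "AE x in lborel. norm (g x / of_real ((x - Re z)\<^sup>2 + (Im z)\<^sup>2))
      \<le> norm (B * (1 / ((x - Re z)\<^sup>2 + (Im z)\<^sup>2)))"
    by (intro AE_I2) (simp add: abs_mult)
qed (use assms in measurable)

text \<open>Connects the gauge integral over a segment, which a contour integral along the real axis
  produces, with the Lebesgue integral over the line.\<close>

lemma integral_interval_tendsto_lborel:
  fixes f :: "real \<Rightarrow> complex"
  assumes int: "integrable lborel f" and cont: "continuous_on UNIV f"
  shows "((\<lambda>R. integral {-R..R} f) \<longlongrightarrow> (\<integral>x. f x \<partial>lborel)) at_top"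
proof -
  have "((\<lambda>R. \<integral>x. indicator {-R..R} x *\<^sub>R f x \<partial>lborel) \<longlongrightarrow> (\<integral>x. f x \<partial>lborel)) at_top"
  proof (rule integral_dominated_convergence_at_top[where w = "\<lambda>x. norm (f x)"])
    show "AE x in lborel. ((\<lambda>R. indicator {-R..R} x *\<^sub>R f x) \<longlongrightarrow> f x) at_top"
    proof (rule AE_I2, rule tendsto_eventually)
      fix x :: real
      show "eventually (\<lambda>R. indicator {-R..R} x *\<^sub>R f x = f x) at_top"
        using eventually_ge_at_top[of "\<bar>x\<bar>"] by eventually_elim (auto simp: indicator_def)
    qed
  qed (use int in \<open>auto split: split_indicator\<close>)
  moreover have "(\<integral>x. indicator {-R..R} x *\<^sub>R f x \<partial>lborel) = integral {-R..R} f" for R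
    using set_borel_integral_eq_integral(2)[of "{-R..R}" f]
      borel_integrable_atLeastAtMost'[of "-R" R f] continuous_on_subset[OF cont]
    by (simp add: set_lebesgue_integral_def)
  ultimately show ?thesis by simp
qed

text \<open>Cauchy's formula on the boundary of a half disc for \<open>g w / (w - cnj z)\<close>,
  whose value at \<open>z\<close> is \<open>g z / (2 * \<i> * Im z)\<close>. The segment contributes
  the integral; the error bound is the arc length \<open>pi * R\<close> times a bound for the
  integrand on the arc.\<close>

lemma semicircle_poisson:
  fixes g :: "complex \<Rightarrow> complex"
  assumes e: "e > 0" and hol: "g holomorphic_on {w. Im w > -e}"
    and bd: "\<And>w. Im w \<ge> 0 \<Longrightarrow> norm (g w) \<le> B"
    and z: "Im z > 0" and R: "R > norm z"
  shows "norm (integral {-R..R} (\<lambda>x. g (of_real x) / of_real ((x - Re z)\<^sup>2 + (Im z)\<^sup>2))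
      - pi / Im z * winding_number (linepath (-of_real R) (of_real R) +++ part_circlepath 0 R 0 pi) z * g z)
    \<le> B * pi * R / (R - norm z)\<^sup>2"
proof -
  \<comment> \<open>A convex open half-plane inside the domain of \<open>g\<close> that contains the
    closed upper half-plane but misses the second pole \<open>cnj z\<close>.\<close>
  define S where "S = {w. Im w > - min e (Im z)}"
  let ?\<gamma>1 = "linepath (-of_real R) (of_real R) :: real \<Rightarrow> complex"
  let ?\<gamma>2 = "part_circlepath 0 R 0 pi"
  let ?\<gamma> = "?\<gamma>1 +++ ?\<gamma>2"
  define K where "K w = g w / (w - cnj z)" for w
    \<comment> \<open>on the real line \<open>K w / (w - z)\<close> is the Poisson kernel times \<open>g\<close>\<close>
  have R0: "R > 0" using R norm_ge_zero[of z] by linarith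
  have S: "convex S" "open S"
    unfolding S_def by (rule convex_halfspace_Im_gt, rule open_halfspace_Im_gt)
  have holK: "K holomorphic_on S"
    unfolding K_def
    by (intro holomorphic_intros holomorphic_on_subset[OF hol]) (auto simp: S_def complex_eq_iff)
  have zS: "z \<in> interior S"
    using S z e by (simp add: interior_open S_def)
  have p1: "Im w = 0" if "w \<in> path_image ?\<gamma>1" for w
    using that by (auto simp: path_image_linepath closed_segment_def)
  have p2: "Im w \<ge> 0" "norm w = R" if "w \<in> path_image ?\<gamma>2" for w
  proof -
    from that obtain \<theta> where "0 \<le> \<theta>" "\<theta> \<le> pi" "w = of_real R * exp (\<i> * of_real \<theta>)"
      using path_image_part_circlepath[of 0 pi 0 R] by auto
    then show "Im w \<ge> 0" "norm w = R"
      using R0 sin_ge_zero[of \<theta>] by (auto simp: norm_mult Im_exp)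
  qed
  have path: "path_image ?\<gamma> \<subseteq> S - {z}"
  proof -
    have "w \<in> S - {z}" if "w \<in> path_image ?\<gamma>1 \<union> path_image ?\<gamma>2" for w
      using that p1[of w] p2[of w] z e R by (auto simp: S_def)
    then show ?thesis using path_image_join_subset[of ?\<gamma>1 ?\<gamma>2] by blast
  qed
  have "((\<lambda>w. K w / (w - z)) has_contour_integral (2 * pi * \<i> * winding_number ?\<gamma> z * K z)) ?\<gamma>"
    by (rule Cauchy_integral_formula_convex_simple[OF S(1) holK zS _ path])
       (auto simp: valid_path_join exp_Euler simp flip: cis_conv_exp)
  then have "(\<lambda>w. K w / (w - z)) contour_integrable_on ?\<gamma>"
    and full: "contour_integral ?\<gamma> (\<lambda>w. K w / (w - z)) = 2 * pi * \<i> * winding_number ?\<gamma> z * K z"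
    unfolding contour_integrable_on_def by (blast, rule contour_integral_unique)
  then have "(\<lambda>w. K w / (w - z)) contour_integrable_on ?\<gamma>1" "(\<lambda>w. K w / (w - z)) contour_integrable_on ?\<gamma>2"
    by (auto intro: contour_integrable_joinD1 contour_integrable_joinD2)
  then obtain I1 I2 where I1: "((\<lambda>w. K w / (w - z)) has_contour_integral I1) ?\<gamma>1"
    and I2: "((\<lambda>w. K w / (w - z)) has_contour_integral I2) ?\<gamma>2"
    and I: "2 * pi * \<i> * winding_number ?\<gamma> z * K z = I1 + I2"
    using contour_integral_join[of "\<lambda>w. K w / (w - z)" ?\<gamma>1 ?\<gamma>2] full
    by (auto dest!: has_contour_integral_integral)
  have "z - cnj z = 2 * \<i> * Im z" by (simp add: complex_eq_iff)
  then have Kz: "K z = g z / (2 * \<i> * Im z)" by (simp only: K_def)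
  have "2 * pi * \<i> * winding_number ?\<gamma> z * K z = pi / Im z * winding_number ?\<gamma> z * g z"
    unfolding Kz using z by (simp add: field_simps)
  moreover have "I1 = integral {-R..R} (\<lambda>x. g (of_real x) / of_real ((x - Re z)\<^sup>2 + (Im z)\<^sup>2))"
  proof -
    have "((\<lambda>x. K (of_real x) / (of_real x - z)) has_integral I1) {-R..R}"
      using I1 R0 by (subst (asm) has_contour_integral_linepath_Reals_iff) auto
    moreover have "K (of_real x) / (of_real x - z) = g (of_real x) / of_real ((x - Re z)\<^sup>2 + (Im z)\<^sup>2)" for x
    proof -
      have "(of_real x - cnj z) * (of_real x - z) = of_real ((x - Re z)\<^sup>2 + (Im z)\<^sup>2)"
        by (auto simp: complex_eq_iff power2_eq_square algebra_simps)
      then show ?thesis by (simp add: K_def)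
    qed
    ultimately show ?thesis by (simp add: integral_unique)
  qed
  moreover have "norm I2 \<le> B / (R - norm z)\<^sup>2 * R * (pi - 0)"
  proof (rule has_contour_integral_bound_part_circlepath[OF I2])
    have B: "B \<ge> 0" using bd[of 0] norm_ge_zero[of "g 0"] by (simp del: norm_ge_zero)
    then show "0 \<le> B / (R - norm z)\<^sup>2" by simp
    fix w assume w: "w \<in> path_image ?\<gamma>2"
    have "R - norm z \<le> norm (w - z)" "R - norm z \<le> norm (w - cnj z)"
      using norm_triangle_ineq2[of w z] norm_triangle_ineq2[of w "cnj z"] p2[OF w] by auto
    then have "(R - norm z)\<^sup>2 \<le> norm (w - cnj z) * norm (w - z)"
      unfolding power2_eq_square using R by (intro mult_mono) auto
    then show "norm (K w / (w - z)) \<le> B / (R - norm z)\<^sup>2"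
      unfolding K_def norm_divide norm_mult divide_divide_eq_left
      using bd[OF p2(1)[OF w]] R B by (intro frac_le) auto
  qed (use R0 in auto)
  ultimately show ?thesis using I by (simp add: norm_minus_commute algebra_simps)
qed

text \<open>
  The winding number of the semicircle need not be computed: applying \<open>semicircle_poisson\<close> to the
  constant function 1 shows that \<open>pi / Im z\<close> times it tends to \<open>\<integral>1/\<bar>x - z\<bar>\<^sup>2 dx = pi / Im z\<close>.
\<close>
lemma poisson_half_plane:
  fixes g :: "complex \<Rightarrow> complex"
  assumes e: "e > 0" and hol: "g holomorphic_on {w. Im w > -e}"
    and bd: "\<And>w. Im w \<ge> 0 \<Longrightarrow> norm (g w) \<le> B"
    and z: "Im z > 0"
  shows "g z = Im z / pi * (\<integral>x. g (of_real x) / of_real ((x - Re z)\<^sup>2 + (Im z)\<^sup>2) \<partial>lborel)"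
proof -
  define W where
    "W R = pi / Im z * winding_number (linepath (-of_real R) (of_real R) +++ part_circlepath 0 R 0 pi) z" for R
  have lim: "((\<lambda>R. W R * h z) \<longlongrightarrow> (\<integral>x. h (of_real x) / of_real ((x - Re z)\<^sup>2 + (Im z)\<^sup>2) \<partial>lborel)) at_top"
    if h: "h holomorphic_on {w. Im w > -e}" "\<And>w. Im w \<ge> 0 \<Longrightarrow> norm (h w) \<le> C" for h C
  proof -
    let ?A = "\<lambda>R. integral {-R..R} (\<lambda>x. h (of_real x) / of_real ((x - Re z)\<^sup>2 + (Im z)\<^sup>2))"
    have cont: "continuous_on UNIV (\<lambda>x::real. h (of_real x))"
      by (rule continuous_on_compose2[OF holomorphic_on_imp_continuous_on[OF h(1)]])
         (use e in \<open>auto intro!: continuous_intros\<close>)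
    have nz: "(x - Re z)\<^sup>2 + (Im z)\<^sup>2 \<noteq> 0" for x
      using z by (simp add: sum_power2_eq_zero_iff)
    have "(?A \<longlongrightarrow> (\<integral>x. h (of_real x) / of_real ((x - Re z)\<^sup>2 + (Im z)\<^sup>2) \<partial>lborel)) at_top"
    proof (rule integral_interval_tendsto_lborel)
      show "integrable lborel (\<lambda>x. h (of_real x) / of_real ((x - Re z)\<^sup>2 + (Im z)\<^sup>2))"
        by (rule integrable_poisson_bounded[OF z borel_measurable_continuous_onI[OF cont], where B = C])
           (use h(2) in auto)
      show "continuous_on UNIV (\<lambda>x. h (of_real x) / of_real ((x - Re z)\<^sup>2 + (Im z)\<^sup>2))"
        using nz by (intro continuous_intros cont) (metis of_real_eq_0_iff)
    qed
    moreover have "((\<lambda>R. W R * h z - ?A R) \<longlongrightarrow> 0) at_top"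
    proof (rule Lim_null_comparison)
      show "eventually (\<lambda>R. norm (W R * h z - ?A R) \<le> C * pi * R / (R - norm z)\<^sup>2) at_top"
        using eventually_gt_at_top[of "norm z"]
      proof eventually_elim
        case (elim R)
        from semicircle_poisson[OF e h z elim] show ?case
          unfolding W_def by (simp add: norm_minus_commute)
      qed
      show "((\<lambda>R. C * pi * R / (R - norm z)\<^sup>2) \<longlongrightarrow> 0) at_top"
        by real_asymp
    qed
    from tendsto_add[OF this calculation] show ?thesis by simp
  qed
  have "(\<integral>x. 1 / complex_of_real ((x - Re z)\<^sup>2 + (Im z)\<^sup>2) \<partial>lborel) = of_real (pi / Im z)"
    using integral_complex_of_real[of lborel "\<lambda>x. 1 / ((x - Re z)\<^sup>2 + (Im z)\<^sup>2)"]
    unfolding integral_poisson_kernel[OF z] by (simp only: of_real_divide of_real_1)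
  then have "(W \<longlongrightarrow> pi / Im z) at_top"
    using lim[of "\<lambda>_. 1" 1] by simp
  then have "((\<lambda>R. W R * g z) \<longlongrightarrow> pi / Im z * g z) at_top"
    by (intro tendsto_intros)
  from tendsto_unique[OF _ this lim[OF hol bd]] z
  have eq: "pi / Im z * g z = (\<integral>x. g (of_real x) / of_real ((x - Re z)\<^sup>2 + (Im z)\<^sup>2) \<partial>lborel)"
    by simp
  show ?thesis unfolding eq[symmetric] using z by simp
qed

section \<open>Cauchy transforms of probability measures\<close>

context real_distribution
begin

lemma norm_cauchy_G_le:
  assumes z: "Im z > 0"
  shows "norm (cauchy_G M z) \<le> 1 / Im z"
proof -
  have "norm (cauchy_G M z) \<le> (\<integral>x. norm (1 / (z - of_real x)) \<partial>M)"
    unfolding cauchy_G_def by (rule integral_norm_bound)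
  also have "\<dots> \<le> (\<integral>x. 1 / Im z \<partial>M)"
    by (intro integral_mono cauchy_kernel_bound z integrable_norm integrable_cauchy_kernel) auto
  finally show ?thesis by (simp add: prob_space[unfolded space_eq_univ])
qed

lemma integrable_poisson:
  assumes z: "Im z > 0"
  shows "integrable M (\<lambda>x. 1 / ((x - Re z)\<^sup>2 + (Im z)\<^sup>2))"
proof (rule integrable_const_bound[where B = "1 / (Im z)\<^sup>2"])
  show "AE x in M. norm (1 / ((x - Re z)\<^sup>2 + (Im z)\<^sup>2)) \<le> 1 / (Im z)\<^sup>2"
    using z by (intro AE_I2) (auto intro!: frac_le)
qed auto

lemma Im_cauchy_G:
  assumes z: "Im z > 0"
  shows "Im (cauchy_G M z) = - Im z * (\<integral>x. 1 / ((x - Re z)\<^sup>2 + (Im z)\<^sup>2) \<partial>M)"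
proof -
  have "Im (cauchy_G M z) = (\<integral>x. Im (1 / (z - of_real x)) \<partial>M)"
    unfolding cauchy_G_def by (rule integral_Im[symmetric, OF integrable_cauchy_kernel[OF z]])
  also have "\<dots> = (\<integral>x. - Im z * (1 / ((x - Re z)\<^sup>2 + (Im z)\<^sup>2)) \<partial>M)"
    by (intro Bochner_Integration.integral_cong refl)
       (simp add: Im_divide power2_commute)
  also have "\<dots> = - Im z * (\<integral>x. 1 / ((x - Re z)\<^sup>2 + (Im z)\<^sup>2) \<partial>M)"
    by (rule integral_mult_right_zero)
  finally show ?thesis .
qed

lemma holomorphic_cauchy_G: "cauchy_G M holomorphic_on {z. Im z > 0}"
  unfolding holomorphic_on_open[OF open_halfspace_Im_gt]
  using cauchy_G_has_field_derivative by blast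

text \<open>The right-hand side is the integral of
  \<open>2 * y\<^sup>2 / (x\<^sup>2 + y\<^sup>2) - 1\<close>, which is at most 1 everywhere and at
  most 0 for \<open>\<bar>x\<bar> \<ge> y\<close>, hence lies below the indicator. This turns
  asymptotics of the Cauchy transform into tightness.\<close>

lemma prob_interval_ge:
  assumes y: "y > 0"
  shows "prob {-y<..y} \<ge> - 2 * y * Im (cauchy_G M (\<i> * of_real y)) - 1"
proof -
  have pos: "x\<^sup>2 + y\<^sup>2 > 0" for x using y by (intro add_nonneg_pos) auto
  have int: "integrable M (\<lambda>x. 1 / (x\<^sup>2 + y\<^sup>2))"
    using integrable_poisson[of "\<i> * of_real y"] y by simp
  have "(\<integral>x. 2 * y\<^sup>2 * (1 / (x\<^sup>2 + y\<^sup>2)) - 1 \<partial>M) = 2 * y\<^sup>2 * (\<integral>x. 1 / (x\<^sup>2 + y\<^sup>2) \<partial>M) - 1"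
    by (subst Bochner_Integration.integral_diff[OF integrable_mult_right[OF int]])
       (simp_all only: integral_mult_right_zero integrable_const lebesgue_integral_const prob_space, simp)
  then have "- 2 * y * Im (cauchy_G M (\<i> * of_real y)) - 1 = (\<integral>x. 2 * y\<^sup>2 * (1 / (x\<^sup>2 + y\<^sup>2)) - 1 \<partial>M)"
    using Im_cauchy_G[of "\<i> * of_real y"] y by (simp add: power2_eq_square)
  also have "\<dots> \<le> (\<integral>x. indicator {-y<..y} x \<partial>M)"
  proof (rule integral_mono)
    fix x
    show "2 * y\<^sup>2 * (1 / (x\<^sup>2 + y\<^sup>2)) - 1 \<le> indicator {-y<..y} x"
    proof (cases "x \<in> {-y<..y}")
      case True
      then show ?thesis using pos[of x] by (simp add: pos_divide_le_eq)
    next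
      case False
      then have "y\<^sup>2 \<le> x\<^sup>2" using y by (intro abs_le_square_iff[THEN iffD1]) auto
      then show ?thesis using False pos[of x] by (simp add: pos_divide_le_eq)
    qed
  next
    show "integrable M (\<lambda>x. 2 * y\<^sup>2 * (1 / (x\<^sup>2 + y\<^sup>2)) - 1)"
      by (intro Bochner_Integration.integrable_diff integrable_mult_right int) auto
    show "integrable M (indicator {-y<..y} :: real \<Rightarrow> real)"
      by (intro integrable_real_indicator) (auto simp: less_top[symmetric])
  qed
  finally show ?thesis by simp
qed

end

section \<open>Stieltjes inversion and the representation of functions as Cauchy transforms\<close>

text \<open>By the open mapping theorem the image of a nonconstant function would be open and so
  contain nonreal points.\<close>

lemma real_valued_holomorphic_constant:
  fixes f :: "complex \<Rightarrow> complex"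
  assumes hol: "f holomorphic_on S" and S: "open S" "connected S"
    and im: "\<And>z. z \<in> S \<Longrightarrow> Im (f z) = 0"
  shows "f constant_on S"
proof (rule ccontr)
  assume nc: "\<not> f constant_on S"
  then obtain a where a: "a \<in> S" by (auto simp: constant_on_def)
  have "open (f ` S)"
    by (rule open_mapping_thm[OF hol S S(1) order_refl nc])
  with a obtain e where e: "e > 0" "ball (f a) e \<subseteq> f ` S"
    unfolding open_contains_ball by blast
  have "f a + \<i> * of_real (e / 2) \<in> ball (f a) e"
    using e(1) by (simp add: dist_norm norm_mult)
  then obtain w where "w \<in> S" "f w = f a + \<i> * of_real (e / 2)"
    using e(2) by fastforce
  then show False using im[of w] im[OF a] e(1) by simp
qed

lemma connected_upper_half_plane: "connected {z. Im z > c}"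
  by (rule convex_connected[OF convex_halfspace_Im_gt])

lemma real_distribution_density:
  fixes f :: "real \<Rightarrow> real"
  assumes "integrable lborel f" "\<And>x. f x \<ge> 0" "(\<integral>x. f x \<partial>lborel) = 1"
  shows "real_distribution (density lborel (\<lambda>x. ennreal (f x)))"
proof -
  have [measurable]: "f \<in> borel_measurable borel"
    using borel_measurable_integrable[OF assms(1)] by simp
  have "emeasure (density lborel (\<lambda>x. ennreal (f x))) UNIV = (\<integral>\<^sup>+x. ennreal (f x) \<partial>lborel)"
    by (subst emeasure_density) auto
  also have "\<dots> = 1"
    using nn_integral_eq_integral[OF assms(1)] assms(2,3) by simp
  finally show ?thesis
    by (intro real_distribution.intro prob_spaceI real_distribution_axioms.intro) auto
qed

text \<open>Stieltjes inversion: the measure has density \<open>- Im (g x) / pi\<close>. By the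
  Poisson formula its Cauchy transform has the same imaginary part as \<open>g\<close>, so the two
  differ by a constant, which vanishes because both are bounded by \<open>1 / Im z\<close>.\<close>

lemma cauchy_G_density_representation:
  fixes g :: "complex \<Rightarrow> complex"
  assumes e: "e > 0" and hol: "g holomorphic_on {w. Im w > -e}"
    and bd0: "\<And>w. Im w \<ge> 0 \<Longrightarrow> norm (g w) \<le> B"
    and bd: "\<And>w. Im w > 0 \<Longrightarrow> norm (g w) \<le> 1 / Im w"
    and neg: "\<And>x. Im (g (of_real x)) \<le> 0"
    and lim: "((\<lambda>y. \<i> * of_real y * g (\<i> * of_real y)) \<longlongrightarrow> 1) at_top"
  shows "\<exists>M. real_distribution M \<and> (\<forall>z. Im z > 0 \<longrightarrow> cauchy_G M z = g z)"
proof -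
  define f where "f x = - Im (g (of_real x)) / pi" for x :: real
  have f0: "f x \<ge> 0" for x using neg[of x] by (simp add: f_def divide_nonpos_pos)
  have contg: "continuous_on UNIV (\<lambda>x::real. g (of_real x))"
    by (rule continuous_on_compose2[OF holomorphic_on_imp_continuous_on[OF hol]])
       (use e in \<open>auto intro!: continuous_intros\<close>)
  then have contf: "continuous_on UNIV f"
    unfolding f_def by (intro continuous_intros) auto
  have [measurable]: "f \<in> borel_measurable borel"
    by (rule borel_measurable_continuous_onI[OF contf])
  have
    int: "integrable lborel (\<lambda>x. f x / ((x - Re z)\<^sup>2 + (Im z)\<^sup>2))" and
    Im_g: "- Im (g z) = Im z * (\<integral>x. f x / ((x - Re z)\<^sup>2 + (Im z)\<^sup>2) \<partial>lborel)" if z: "Im z > 0" for z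
  proof -
    let ?k = "\<lambda>x. g (of_real x) / complex_of_real ((x - Re z)\<^sup>2 + (Im z)\<^sup>2)"
    have i: "integrable lborel ?k"
      by (rule integrable_poisson_bounded[OF z borel_measurable_continuous_onI[OF contg], where B = B])
         (use bd0 in auto)
    have eq: "f x / ((x - Re z)\<^sup>2 + (Im z)\<^sup>2) = - 1 / pi * Im (?k x)" for x
      unfolding f_def Im_divide_of_real by simp
    show "integrable lborel (\<lambda>x. f x / ((x - Re z)\<^sup>2 + (Im z)\<^sup>2))"
      unfolding eq by (intro integrable_mult_right integrable_Im i)
    have "Im (g z) = Im (of_real (Im z / pi) * (\<integral>x. ?k x \<partial>lborel))"
      using poisson_half_plane[OF e hol bd0 z] by simp
    also have "\<dots> = Im z / pi * (\<integral>x. Im (?k x) \<partial>lborel)"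
      unfolding integral_Im[OF i] by (simp add: of_real_divide flip: of_real_mult)
    finally show "- Im (g z) = Im z * (\<integral>x. f x / ((x - Re z)\<^sup>2 + (Im z)\<^sup>2) \<partial>lborel)"
      unfolding eq integral_mult_right_zero by simp
  qed
  \<comment> \<open>Monotone convergence: \<open>r\<^sup>2 * f x / (x\<^sup>2 + r\<^sup>2)\<close>
    increases to \<open>f x\<close> with \<open>r\<close>, and its integral
    \<open>- r * Im (g (\<i> * r))\<close> tends to 1 by \<open>lim\<close>.\<close>
  have f1: "integrable lborel f" "(\<integral>x. f x \<partial>lborel) = 1"
  proof -
    let ?r = "\<lambda>n. real (Suc n)"
    let ?h = "\<lambda>n x. (?r n)\<^sup>2 * (f x / (x\<^sup>2 + (?r n)\<^sup>2))"
    have A: "integrable lborel (?h n)" for n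
      using int[of "\<i> * of_real (?r n)"] by (intro integrable_mult_right) simp
    have B: "AE x in lborel. mono (\<lambda>n. ?h n x)"
    proof (intro AE_I2 monoI)
      fix x :: real and m n :: nat
      assume "m \<le> n"
      then have mn: "(?r m)\<^sup>2 \<le> (?r n)\<^sup>2" by (intro power_mono) auto
      have p: "x\<^sup>2 + (?r k)\<^sup>2 > 0" for k by (intro add_nonneg_pos) auto
      have "(?r m)\<^sup>2 / (x\<^sup>2 + (?r m)\<^sup>2) \<le> (?r n)\<^sup>2 / (x\<^sup>2 + (?r n)\<^sup>2)"
        using p[of m] p[of n] mult_left_mono[OF mn, of "x\<^sup>2"]
        by (simp add: field_simps del: of_nat_Suc)
      from mult_right_mono[OF this f0[of x]] show "?h m x \<le> ?h n x" by simp
    qed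
    have C: "AE x in lborel. (\<lambda>n. ?h n x) \<longlonglongrightarrow> f x"
    proof (rule AE_I2)
      fix x
      have "(\<lambda>n. (?r n)\<^sup>2 / (x\<^sup>2 + (?r n)\<^sup>2)) \<longlonglongrightarrow> 1" by real_asymp
      from tendsto_mult_right[OF this, of "f x"] show "(\<lambda>n. ?h n x) \<longlonglongrightarrow> f x" by simp
    qed
    have "(\<lambda>n. \<i> * of_real (?r n) * g (\<i> * of_real (?r n))) \<longlonglongrightarrow> 1"
      by (rule filterlim_compose[OF lim]) real_asymp
    from tendsto_Re[OF this] have "(\<lambda>n. ?r n * - Im (g (\<i> * of_real (?r n)))) \<longlonglongrightarrow> 1"
      by simp
    moreover have "(\<integral>x. ?h n x \<partial>lborel) = ?r n * - Im (g (\<i> * of_real (?r n)))" for n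
      unfolding integral_mult_right_zero by (subst Im_g) (simp_all add: power2_eq_square)
    ultimately have D: "(\<lambda>n. \<integral>x. ?h n x \<partial>lborel) \<longlonglongrightarrow> 1" by simp
    show "integrable lborel f" "(\<integral>x. f x \<partial>lborel) = 1"
      by (rule integrable_monotone_convergence[OF A B C D] integral_monotone_convergence[OF A B C D]; simp)+
  qed
  define M where "M = density lborel (\<lambda>x. ennreal (f x))"
  interpret M: real_distribution M
    unfolding M_def by (rule real_distribution_density[OF f1(1) f0 f1(2)])
  have ImG: "Im (cauchy_G M z) = Im (g z)" if z: "Im z > 0" for z
  proof -
    have "(\<integral>x. 1 / ((x - Re z)\<^sup>2 + (Im z)\<^sup>2) \<partial>M) = (\<integral>x. f x / ((x - Re z)\<^sup>2 + (Im z)\<^sup>2) \<partial>lborel)"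
      unfolding M_def using f0 by (subst integral_density) auto
    then show ?thesis using M.Im_cauchy_G[OF z] Im_g[OF z] by simp
  qed
  let ?D = "\<lambda>z. cauchy_G M z - g z"
  have "?D constant_on {z. Im z > 0}"
  proof (rule real_valued_holomorphic_constant)
    show "?D holomorphic_on {z. Im z > 0}"
      by (intro holomorphic_intros M.holomorphic_cauchy_G holomorphic_on_subset[OF hol]) (use e in auto)
  qed (use ImG in \<open>auto simp: open_halfspace_Im_gt connected_upper_half_plane\<close>)
  then obtain c where c: "\<And>z. Im z > 0 \<Longrightarrow> ?D z = c" by (auto simp: constant_on_def)
  have cy: "norm c \<le> 2 / y" if y: "y > 0" for y :: real
    using norm_triangle_ineq4[of "cauchy_G M (\<i> * of_real y)" "g (\<i> * of_real y)"]
      M.norm_cauchy_G_le[of "\<i> * of_real y"] bd[of "\<i> * of_real y"] c[of "\<i> * of_real y"] y by simp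
  have "eventually (\<lambda>y. norm c \<le> 2 / y) at_top"
    by (rule eventually_mono[OF eventually_gt_at_top[of 0] cy])
  moreover have "((\<lambda>y::real. 2 / y) \<longlongrightarrow> 0) at_top" by real_asymp
  ultimately have "norm c \<le> 0"
    by (intro tendsto_le[OF _ _ tendsto_const[of "norm c"]]) auto
  then have "cauchy_G M z = g z" if "Im z > 0" for z using c[OF that] by simp
  then show ?thesis using M.real_distribution_axioms by blast
qed

text \<open>
  The shifts \<open>G(\<cdot> + i e)\<close> extend past the real axis, so they are Cauchy transforms of densities; the
  normalisation at infinity is uniform in \<open>e \<le> 1\<close>, which makes these densities tight, and a weak
  limit as \<open>e \<rightarrow> 0\<close> represents \<open>G\<close>.
\<close>
theorem cauchy_G_representation:
  fixes G :: "complex \<Rightarrow> complex"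
  assumes hol: "G holomorphic_on {z. Im z > 0}"
    and bd: "\<And>z. Im z > 0 \<Longrightarrow> norm (G z) \<le> 1 / Im z"
    and neg: "\<And>z. Im z > 0 \<Longrightarrow> Im (G z) \<le> 0"
    and lim: "((\<lambda>y. \<i> * of_real y * G (\<i> * of_real y)) \<longlongrightarrow> 1) at_top"
  shows "\<exists>M. real_distribution M \<and> (\<forall>z. Im z > 0 \<longrightarrow> cauchy_G M z = G z)"
proof -
  define e where "e n = 1 / real (Suc n)" for n
  have e: "e n > 0" "e n \<le> 1" for n by (auto simp: e_def)
  have "\<exists>M. real_distribution M \<and> (\<forall>z. Im z > 0 \<longrightarrow> cauchy_G M z = G (z + \<i> * of_real (e n)))" for n
  proof (rule cauchy_G_density_representation)
    show "e n > 0" by (rule e)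
    show "(\<lambda>z. G (z + \<i> * of_real (e n))) holomorphic_on {w. Im w > - e n}"
      by (rule holomorphic_on_compose_gen[OF _ hol, unfolded o_def]) (auto intro!: holomorphic_intros)
    show "norm (G (w + \<i> * of_real (e n))) \<le> 1 / e n" if "Im w \<ge> 0" for w
    proof -
      have "norm (G (w + \<i> * of_real (e n))) \<le> 1 / (Im w + e n)"
        using bd[of "w + \<i> * of_real (e n)"] that e(1)[of n] by simp
      also have "\<dots> \<le> 1 / e n" using that e(1)[of n] by (intro frac_le) auto
      finally show ?thesis .
    qed
    show "norm (G (w + \<i> * of_real (e n))) \<le> 1 / Im w" if "Im w > 0" for w
    proof -
      have "norm (G (w + \<i> * of_real (e n))) \<le> 1 / (Im w + e n)"
        using bd[of "w + \<i> * of_real (e n)"] that e(1)[of n] by simp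
      also have "\<dots> \<le> 1 / Im w" using that e(1)[of n] by (intro frac_le) auto
      finally show ?thesis .
    qed
    show "Im (G (of_real x + \<i> * of_real (e n))) \<le> 0" for x
      using neg[of "of_real x + \<i> * of_real (e n)"] e(1)[of n] by simp
    have "((\<lambda>y. \<i> * of_real (y + e n) * G (\<i> * of_real (y + e n))) \<longlongrightarrow> 1) at_top"
      by (rule filterlim_compose[OF lim]) real_asymp
    moreover have "((\<lambda>y. of_real (y / (y + e n)) :: complex) \<longlongrightarrow> of_real 1) at_top"
      by (intro tendsto_of_real) real_asymp
    ultimately have "((\<lambda>y. of_real (y / (y + e n)) * (\<i> * of_real (y + e n) * G (\<i> * of_real (y + e n)))) \<longlongrightarrow> of_real 1 * 1) at_top"
      by (intro tendsto_mult)
    moreover have "eventually (\<lambda>y. of_real (y / (y + e n)) * (\<i> * of_real (y + e n) * G (\<i> * of_real (y + e n)))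
        = \<i> * of_real y * G (\<i> * of_real y + \<i> * of_real (e n))) at_top"
      using eventually_gt_at_top[of 0]
    proof eventually_elim
      case (elim y)
      have "complex_of_real (y + e n) \<noteq> 0"
        using elim e(1)[of n] by (metis add_pos_pos less_irrefl of_real_eq_0_iff)
      then show ?case by (simp add: field_simps)
    qed
    ultimately show "((\<lambda>y. \<i> * of_real y * G (\<i> * of_real y + \<i> * of_real (e n))) \<longlongrightarrow> 1) at_top"
      by (auto intro: Lim_transform_eventually)
  qed
  then obtain N where N: "\<And>n. real_distribution (N n)"
    and NG: "\<And>n z. Im z > 0 \<Longrightarrow> cauchy_G (N n) z = G (z + \<i> * of_real (e n))"
    by metis
  have "\<exists>a b. a < b \<and> (\<forall>n. 1 - \<epsilon> < measure (N n) {a<..b})" if eps: "\<epsilon> > 0" for \<epsilon>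
  proof -
    \<comment> \<open>One \<open>d\<close> is lost to the limit and one to replacing
      \<open>y + e n\<close> by \<open>y\<close>; \<open>prob_interval_ge\<close> doubles this to
      \<open>4 * d = \<epsilon> / 2\<close>.\<close>
    define d where "d = \<epsilon> / 8"
    have d: "d > 0" using eps by (simp add: d_def)
    have "eventually (\<lambda>y. norm (\<i> * of_real y * G (\<i> * of_real y) - 1) < d) at_top"
      using lim d unfolding tendsto_iff dist_norm by blast
    then obtain Y where Y: "\<And>y. y \<ge> Y \<Longrightarrow> norm (\<i> * of_real y * G (\<i> * of_real y) - 1) < d"
      by (auto simp: eventually_at_top_linorder)
    \<comment> \<open>\<open>y \<ge> 1 / d\<close> forces \<open>- Im G \<le> d\<close> at height
      \<open>y + e n\<close>; as \<open>e n \<le> 1\<close>, the cost of the shift is at most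
      \<open>d\<close> for every \<open>n\<close>.\<close>
    define y where "y = max Y (1 / d)"
    have y: "y \<ge> Y" "y \<ge> 1 / d" "y > 0" using d by (auto simp: y_def intro: less_le_trans[of _ "1 / d"])
    have "1 - \<epsilon> < measure (N n) {-y<..y}" for n
    proof -
      interpret N: real_distribution "N n" by (rule N)
      let ?w = "\<i> * complex_of_real (y + e n)"
      have w: "Im ?w > 0" using y e(1)[of n] by simp
      have "1 - d \<le> Re (?w * G ?w)"
        using Y[of "y + e n"] y e(1)[of n] abs_Re_le_cmod[of "?w * G ?w - 1"] by simp
      then have 1: "1 - d \<le> (y + e n) * - Im (G ?w)" by simp
      have "- Im (G ?w) \<le> 1 / (y + e n)"
        using abs_Im_le_cmod[of "G ?w"] bd[OF w] by simp
      also have "\<dots> \<le> 1 / y" using y e(1)[of n] by (intro frac_le) auto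
      also have "\<dots> \<le> d" using y d by (simp add: field_simps)
      finally have "e n * - Im (G ?w) \<le> 1 * d"
        using e[of n] neg[OF w] by (intro mult_mono) auto
      with 1 have "1 - 2 * d \<le> y * - Im (G ?w)" by (simp add: algebra_simps)
      moreover have "cauchy_G (N n) (\<i> * of_real y) = G ?w"
        using NG[of "\<i> * of_real y" n] y by (simp add: algebra_simps)
      ultimately have "1 - 4 * d \<le> measure (N n) {-y<..y}"
        using N.prob_interval_ge[OF y(3)] by (simp add: algebra_simps)
      then show ?thesis using eps by (simp add: d_def)
    qed
    then show ?thesis using y(3) by (intro exI[of _ "-y"] exI[of _ y]) auto
  qed
  then have "tight N" using N by (auto simp: tight_def)
  from tight_imp_convergent_subsubsequence[OF this strict_mono_id]
  obtain r M where r: "strict_mono r" and M: "real_distribution M" and conv: "weak_conv_m (N \<circ> r) M"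
    by auto
  \<comment> \<open>For fixed \<open>z\<close> the Cauchy kernel is bounded and continuous in
    \<open>x\<close>, so weak convergence carries over to the Cauchy transforms, while the shifted
    values tend to \<open>G z\<close> by continuity.\<close>
  have "cauchy_G M z = G z" if z: "Im z > 0" for z
  proof -
    have "(\<lambda>n. integral\<^sup>L ((N \<circ> r) n) (\<lambda>x. 1 / (z - complex_of_real x))) \<longlonglongrightarrow>
        integral\<^sup>L M (\<lambda>x. 1 / (z - of_real x))"
    proof (rule weak_conv_imp_integral_bdd_continuous_conv[OF _ M conv, where B = "1 / Im z"])
      show "real_distribution ((N \<circ> r) n)" for n using N by simp
      show "isCont (\<lambda>x. 1 / (z - complex_of_real x)) x" for x
        using cauchy_kernel_nz[OF z, of x] by (intro continuous_intros) auto
      show "norm (1 / (z - complex_of_real x)) \<le> 1 / Im z" for x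
        by (rule cauchy_kernel_bound[OF z])
    qed
    then have "(\<lambda>n. G (z + \<i> * of_real (e (r n)))) \<longlonglongrightarrow> cauchy_G M z"
      by (simp add: NG[OF z, symmetric] cauchy_G_def)
    moreover have "(\<lambda>n. G (z + \<i> * of_real (e (r n)))) \<longlonglongrightarrow> G z"
    proof (rule isCont_tendsto_compose[where g = G])
      show "isCont G z"
        using z holomorphic_on_imp_continuous_on[OF hol]
        by (auto simp: continuous_on_eq_continuous_at open_halfspace_Im_gt)
      have "e \<longlonglongrightarrow> 0" unfolding e_def by real_asymp
      then have "(\<lambda>n. e (r n)) \<longlonglongrightarrow> 0"
        using LIMSEQ_subseq_LIMSEQ[OF _ r] by (auto simp: o_def)
      then have "(\<lambda>n. z + \<i> * of_real (e (r n))) \<longlonglongrightarrow> z + \<i> * of_real 0"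
        by (intro tendsto_intros)
      then show "(\<lambda>n. z + \<i> * of_real (e (r n))) \<longlonglongrightarrow> z" by simp
    qed
    ultimately show ?thesis by (rule LIMSEQ_unique)
  qed
  then show ?thesis using M by blast
qed

section \<open>Subordination\<close>

text \<open>Compares numerator and denominator of the Cayley transform
  \<open>(a - b) / (a - cnj b)\<close>, so that bounds on such quotients become inequalities between
  imaginary parts.\<close>

lemma norm_diff_cnj_sq: "(norm (a - cnj b))\<^sup>2 = (norm (a - b))\<^sup>2 + 4 * (Im a * Im b)"
  unfolding cmod_power2 by (simp add: power2_eq_square algebra_simps)

lemma norm_cayley_less_1:
  assumes "Im a > 0" "Im b > 0"
  shows "norm ((a - b) / (a - cnj b)) < 1"
proof -
  have "(norm (a - b))\<^sup>2 < (norm (a - cnj b))\<^sup>2"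
    using assms by (simp add: norm_diff_cnj_sq)
  then have "norm (a - b) < norm (a - cnj b)" by (rule power_less_imp_less_base) simp
  then show ?thesis
    by (simp add: norm_divide) (metis le_less_trans norm_ge_zero divide_less_eq_1_pos)
qed

text \<open>This quotient inverts the Cayley transform
  \<open>\<zeta> = (w - b) / (w - cnj b)\<close>; the formula shows that for \<open>Im b > 0\<close>
  it sends the open unit disc into the upper half-plane.\<close>

lemma Im_cayley_inverse:
  "Im ((b - cnj b * \<zeta>) / (1 - \<zeta>)) = Im b * (1 - (norm \<zeta>)\<^sup>2) / (norm (1 - \<zeta>))\<^sup>2"
proof -
  have "(b - cnj b * \<zeta>) / (1 - \<zeta>) = (b - cnj b * \<zeta>) * cnj (1 - \<zeta>) / of_real ((norm (1 - \<zeta>))\<^sup>2)"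
    by (subst complex_div_cnj) simp
  then have "Im ((b - cnj b * \<zeta>) / (1 - \<zeta>)) = Im ((b - cnj b * \<zeta>) * cnj (1 - \<zeta>)) / (norm (1 - \<zeta>))\<^sup>2"
    by (simp only: Im_divide_of_real)
  moreover have "Im ((b - cnj b * \<zeta>) * cnj (1 - \<zeta>)) = Im b * (1 - (norm \<zeta>)\<^sup>2)"
    unfolding cmod_power2 by (simp add: power2_eq_square algebra_simps)
  ultimately show ?thesis by simp
qed

text \<open>The Schwarz lemma for \<open>f\<close> conjugated by the Cayley transforms centred at
  \<open>b\<close> and \<open>f b\<close>. Strict positivity of \<open>Im (f z)\<close> keeps the
  denominator of \<open>k\<close> nonzero and its values in the open disc.\<close>

lemma schwarz_pick_half_plane_strict:
  assumes hol: "f holomorphic_on {z. Im z > 0}"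
    and pos: "\<And>z. Im z > 0 \<Longrightarrow> Im (f z) > 0"
    and a: "Im a > 0" and b: "Im b > 0"
  shows "(norm (f a - f b))\<^sup>2 * (Im a * Im b) \<le> (norm (a - b))\<^sup>2 * (Im (f a) * Im (f b))"
proof -
  define \<phi> where "\<phi> \<zeta> = (b - cnj b * \<zeta>) / (1 - \<zeta>)" for \<zeta>
  define k where "k \<zeta> = (f (\<phi> \<zeta>) - f b) / (f (\<phi> \<zeta>) - cnj (f b))" for \<zeta>
  define \<xi> where "\<xi> = (a - b) / (a - cnj b)"
  have nz: "w - cnj v \<noteq> 0" if "Im w > 0" "Im v > 0" for w v
    using that by (auto simp: complex_eq_iff)
  have \<phi>: "Im (\<phi> \<zeta>) > 0" if "norm \<zeta> < 1" for \<zeta>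
  proof -
    have "\<zeta> \<noteq> 1" using that by auto
    moreover have "(norm \<zeta>)\<^sup>2 < 1" using that by (simp add: power_less_one_iff)
    ultimately show ?thesis unfolding \<phi>_def Im_cayley_inverse
      by (auto intro!: divide_pos_pos mult_pos_pos b)
  qed
  have hol\<phi>: "\<phi> holomorphic_on ball 0 1"
    unfolding \<phi>_def by (intro holomorphic_intros) auto
  have "(f \<circ> \<phi>) holomorphic_on ball 0 1"
    by (rule holomorphic_on_compose_gen[OF hol\<phi> hol]) (use \<phi> in auto)
  then have holk: "k holomorphic_on ball 0 1"
    unfolding k_def o_def
    by (intro holomorphic_intros) (use nz[OF pos pos] \<phi> b in auto)
  have \<xi>: "norm \<xi> < 1" unfolding \<xi>_def by (rule norm_cayley_less_1[OF a b])
  have "norm (k \<xi>) \<le> norm \<xi>"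
  proof (rule Schwarz_Lemma(1)[OF holk _ _ \<xi>])
    show "k 0 = 0" by (simp add: k_def \<phi>_def)
    show "norm (k \<zeta>) < 1" if "norm \<zeta> < 1" for \<zeta>
      unfolding k_def by (intro norm_cayley_less_1 pos \<phi> that b)
  qed
  moreover have "\<phi> \<xi> = a"
  proof -
    have "b - cnj b \<noteq> 0" using nz[OF b b] .
    then show ?thesis using nz[OF a b] unfolding \<phi>_def \<xi>_def
      by (simp add: divide_simps) (simp add: algebra_simps)
  qed
  ultimately have "norm (f a - f b) * norm (a - cnj b) \<le> norm (a - b) * norm (f a - cnj (f b))"
    using nz[OF a b] nz[OF pos[OF a] pos[OF b]]
    by (simp add: k_def \<xi>_def norm_divide divide_simps mult_ac)
  \<comment> \<open>After squaring, \<open>norm_diff_cnj_sq\<close> expands both sides and the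
    common term \<open>(norm (f a - f b))\<^sup>2 * (norm (a - b))\<^sup>2\<close> cancels.\<close>
  then have "(norm (f a - f b) * norm (a - cnj b))\<^sup>2 \<le> (norm (a - b) * norm (f a - cnj (f b)))\<^sup>2"
    by (intro power_mono) auto
  then show ?thesis
    unfolding power_mult_distrib norm_diff_cnj_sq by (simp add: algebra_simps)
qed

text \<open>\<open>f + \<i> * e\<close> falls under the strict case for every \<open>e > 0\<close>,
  and the inequality survives \<open>e \<rightarrow> 0\<close>. The nonstrict form is needed because
  \<open>F - id\<close> is a real constant for a point mass.\<close>

theorem schwarz_pick_half_plane:
  assumes hol: "f holomorphic_on {z. Im z > 0}"
    and nonneg: "\<And>z. Im z > 0 \<Longrightarrow> Im (f z) \<ge> 0"
    and a: "Im a > 0" and b: "Im b > 0"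
  shows "(norm (f a - f b))\<^sup>2 * (Im a * Im b) \<le> (norm (a - b))\<^sup>2 * (Im (f a) * Im (f b))"
proof (rule tendsto_lowerbound)
  have "((\<lambda>e. (norm (a - b))\<^sup>2 * ((Im (f a) + e) * (Im (f b) + e))) \<longlongrightarrow>
      (norm (a - b))\<^sup>2 * ((Im (f a) + 0) * (Im (f b) + 0))) (at_right 0)"
    by (intro tendsto_intros)
  then show "((\<lambda>e. (norm (a - b))\<^sup>2 * ((Im (f a) + e) * (Im (f b) + e))) \<longlongrightarrow>
      (norm (a - b))\<^sup>2 * (Im (f a) * Im (f b))) (at_right 0)"
    by simp
  show "eventually (\<lambda>e. (norm (f a - f b))\<^sup>2 * (Im a * Im b) \<le>
      (norm (a - b))\<^sup>2 * ((Im (f a) + e) * (Im (f b) + e))) (at_right 0)"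
    using eventually_at_right_less[of 0]
  proof eventually_elim
    case (elim e)
    have "(norm ((f a + \<i> * of_real e) - (f b + \<i> * of_real e)))\<^sup>2 * (Im a * Im b) \<le>
        (norm (a - b))\<^sup>2 * (Im (f a + \<i> * of_real e) * Im (f b + \<i> * of_real e))"
      using a b elim nonneg
      by (intro schwarz_pick_half_plane_strict[of "\<lambda>z. f z + \<i> * of_real e"] holomorphic_intros hol)
         (auto intro: add_nonneg_pos)
    then show ?case by simp
  qed
qed simp

section \<open>Inversion of \<open>H\<close> over the upper half-plane\<close>

text \<open>
  Since \<open>s h(w) = w - H w\<close>, the Schwarz--Pick inequality for \<open>h\<close> compares \<open>w - v\<close> with itself
  shifted by \<open>H w - H v\<close>. The bound gives injectivity of \<open>H\<close> where \<open>Im (H w) > 0\<close>, and, with \<open>v\<close>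
  fixed, boundedness of preimages of bounded sets.
\<close>
lemma subordination_expansion:
  assumes hol: "h holomorphic_on {z. Im z > 0}"
    and nonneg: "\<And>z. Im z > 0 \<Longrightarrow> Im (h z) \<ge> 0"
    and s: "s \<ge> 0" and H: "\<And>w. H w = w - of_real s * h w"
    and w: "Im w > 0" "Im (H w) > 0" and v: "Im v > 0" "Im (H v) > 0"
  shows "(1 - sqrt (1 - Im (H v) / Im v)) * norm (w - v) \<le> norm (H w - H v)"
    and "1 - sqrt (1 - Im (H v) / Im v) > 0"
proof -
  \<comment> \<open>\<open>q\<close> equals \<open>s * Im (h v) / Im v\<close>; it is less than 1
    because \<open>Im (H v) > 0\<close>.\<close>
  define q where "q = 1 - Im (H v) / Im v"
  have sh: "of_real s * h u = u - H u" "s * Im (h u) = Im u - Im (H u)" for u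
    by (simp_all add: H)
  have le: "Im (H u) \<le> Im u" if "Im u > 0" for u
    using sh(2)[of u] mult_nonneg_nonneg[OF s nonneg[OF that]] by linarith
  have q: "0 \<le> q" "q < 1" "q * Im v = Im v - Im (H v)"
    using le[OF v(1)] v by (auto simp: q_def field_simps)
  then show "1 - sqrt (1 - Im (H v) / Im v) > 0"
    by (simp add: q_def)
  have "(norm (of_real s * h w - of_real s * h v))\<^sup>2 * (Im w * Im v) = s\<^sup>2 * ((norm (h w - h v))\<^sup>2 * (Im w * Im v))"
    by (simp add: norm_mult power_mult_distrib flip: right_diff_distrib)
  also have "\<dots> \<le> s\<^sup>2 * ((norm (w - v))\<^sup>2 * (Im (h w) * Im (h v)))"
    using schwarz_pick_half_plane[OF hol nonneg w(1) v(1)] by (intro mult_left_mono) auto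
  also have "\<dots> = (norm (w - v))\<^sup>2 * ((s * Im (h w)) * (s * Im (h v)))"
    by (simp add: power2_eq_square)
  also have "\<dots> = (norm (w - v))\<^sup>2 * ((Im w - Im (H w)) * (q * Im v))"
    unfolding sh q ..
  \<comment> \<open>Discarding \<open>Im (H w) > 0\<close> lets \<open>Im w * Im v\<close> cancel
    and leaves a constant that depends on \<open>v\<close> only.\<close>
  also have "\<dots> \<le> (norm (w - v))\<^sup>2 * (Im w * (q * Im v))"
    using w v q le[OF v(1)] by (intro mult_left_mono mult_right_mono) auto
  finally have "(norm (of_real s * h w - of_real s * h v))\<^sup>2 \<le> q * (norm (w - v))\<^sup>2"
    using w v by (simp add: mult_ac)
  then have "norm (of_real s * h w - of_real s * h v) \<le> sqrt (q * (norm (w - v))\<^sup>2)"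
    by (rule real_le_rsqrt)
  also have "\<dots> = sqrt q * norm (w - v)"
    by (simp add: real_sqrt_mult)
  finally have "norm ((w - v) - (H w - H v)) \<le> sqrt q * norm (w - v)"
    unfolding sh by (simp add: algebra_simps)
  then have "norm (w - v) - norm (H w - H v) \<le> sqrt q * norm (w - v)"
    using norm_triangle_ineq2[of "w - v" "H w - H v"] by linarith
  then show "(1 - sqrt (1 - Im (H v) / Im v)) * norm (w - v) \<le> norm (H w - H v)"
    by (simp add: q_def algebra_simps)
qed

text \<open>A connectedness argument: the image of \<open>U\<close> is open because \<open>H\<close>
  is holomorphic and injective there, closed in the half-plane by the expansion bound around
  \<open>v\<close>, and contains \<open>H v\<close>. Since \<open>Im (H w) \<le> Im w\<close>, the
  inverse never lowers imaginary parts.\<close>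

theorem subordination_function_exists:
  assumes hol: "h holomorphic_on {z. Im z > 0}"
    and nonneg: "\<And>z. Im z > 0 \<Longrightarrow> Im (h z) \<ge> 0"
    and s: "s \<ge> 0" and H: "\<And>w. H w = w - of_real s * h w"
    and v: "Im v > 0" "Im (H v) > 0"
  obtains \<omega> where "\<omega> holomorphic_on {z. Im z > 0}"
    "\<And>z. Im z > 0 \<Longrightarrow> Im (\<omega> z) \<ge> Im z" "\<And>z. Im z > 0 \<Longrightarrow> H (\<omega> z) = z"
    "\<And>w. Im w > 0 \<Longrightarrow> Im (H w) > 0 \<Longrightarrow> \<omega> (H w) = w"
proof -
  define P where "P = {z. Im z > 0}"
  define U where "U = {w \<in> P. Im (H w) > 0}"
  have expansion:
    "(1 - sqrt (1 - Im (H b) / Im b)) * norm (a - b) \<le> norm (H a - H b)"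
    "1 - sqrt (1 - Im (H b) / Im b) > 0"
    if "Im a > 0" "Im (H a) > 0" "Im b > 0" "Im (H b) > 0" for a b
    using subordination_expansion[where h = h, OF hol _ s H that] nonneg by auto
  have P: "open P" "connected P"
    by (simp_all add: P_def open_halfspace_Im_gt convex_connected convex_halfspace_Im_gt)
  have holH: "H holomorphic_on P"
    unfolding H P_def by (intro holomorphic_intros hol)
  have contH: "continuous_on P H" by (rule holomorphic_on_imp_continuous_on[OF holH])
  have le: "Im (H u) \<le> Im u" if "Im u > 0" for u
    using mult_nonneg_nonneg[OF s nonneg[OF that]] by (simp add: H)
  have "open (P \<inter> H -` P)"
    by (rule continuous_open_preimage[OF contH P(1) P(1)])
  moreover have "U = P \<inter> H -` P" by (auto simp: U_def P_def)
  ultimately have openU: "open U" by simp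
  have UP: "U \<subseteq> P" and HU: "H ` U \<subseteq> P" by (auto simp: U_def P_def)
  have inj: "inj_on H U"
  proof (rule inj_onI)
    fix x y assume xy: "x \<in> U" "y \<in> U" "H x = H y"
    then have "(1 - sqrt (1 - Im (H y) / Im y)) * norm (x - y) \<le> 0"
      "1 - sqrt (1 - Im (H y) / Im y) > 0"
      using expansion[of x y] by (auto simp: U_def P_def)
    then have "norm (x - y) \<le> 0" by (metis mult_pos_pos not_less)
    then show "x = y" by simp
  qed
  note holU = holomorphic_on_subset[OF holH UP]
  have "closedin (top_of_set P) (H ` U)"
    unfolding closedin_limpt islimpt_sequential
  proof (intro conjI HU allI impI, elim conjE exE)
    fix x l assume "\<forall>n. x n \<in> H ` U - {l}" and l: "l \<in> P" "x \<longlonglongrightarrow> l"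
    then have "\<forall>n. \<exists>w. w \<in> U \<and> x n = H w" by blast
    then obtain w where w: "\<And>n. w n \<in> U" "\<And>n. x n = H (w n)" by metis
    from w(1) have w': "Im (w n) > 0" "Im (H (w n)) > 0" for n
      by (auto simp: U_def P_def)
    obtain B where B: "\<And>n. norm (x n) \<le> B"
      using convergent_imp_bounded[OF l(2)] unfolding bounded_iff by blast
    define c where "c = 1 - sqrt (1 - Im (H v) / Im v)"
    have c: "c > 0" unfolding c_def by (rule expansion(2)[OF v v])
    \<comment> \<open>With the base point \<open>v\<close> fixed, the constant \<open>c\<close> does
      not depend on \<open>n\<close>, so preimages of a convergent sequence stay bounded.\<close>
    have "norm (w n - v) \<le> (B + norm (H v)) / c" for n
    proof -
      have "c * norm (w n - v) \<le> norm (H (w n) - H v)"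
        unfolding c_def by (rule expansion(1)[OF w' v])
      also have "\<dots> \<le> B + norm (H v)"
        using norm_triangle_ineq4[of "H (w n)" "H v"] B[of n] w(2)[of n] by simp
      finally show ?thesis using c by (simp add: pos_le_divide_eq mult.commute)
    qed
    then have "range w \<subseteq> cball v ((B + norm (H v)) / c)"
      by (auto simp: dist_norm norm_minus_commute)
    then have "bounded (range w)" using bounded_cball bounded_subset by blast
    then obtain u r where r: "strict_mono r" and u: "(w \<circ> r) \<longlonglongrightarrow> u"
      using bounded_imp_convergent_subsequence by blast
    have xr: "(\<lambda>n. H (w (r n))) \<longlonglongrightarrow> l"
      using LIMSEQ_subseq_LIMSEQ[OF l(2) r] by (simp add: o_def w(2))
    \<comment> \<open>This keeps the limit of the preimages off the real axis.\<close>
    have "Im l \<le> Im u"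
    proof (rule LIMSEQ_le[OF tendsto_Im[OF xr] tendsto_Im[OF u]])
      show "\<exists>N. \<forall>n\<ge>N. Im (H (w (r n))) \<le> Im ((w \<circ> r) n)"
        using le w' by auto
    qed
    then have uP: "u \<in> P" using l(1) by (simp add: P_def)
    have "(\<lambda>n. H (w (r n))) \<longlonglongrightarrow> H u"
      by (rule continuous_on_tendsto_compose[OF contH u[unfolded o_def] uP])
         (use w' in \<open>simp add: P_def\<close>)
    then have "H u = l" using xr LIMSEQ_unique by blast
    then show "l \<in> H ` U" using uP l(1) by (auto simp: U_def P_def)
  qed
  moreover have "openin (top_of_set P) (H ` U)"
    using open_mapping_thm3[OF holU openU inj] HU by (simp add: openin_open_eq P(1))
  moreover have "H ` U \<noteq> {}" using v by (auto simp: U_def P_def)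
  ultimately have surj: "H ` U = P"
    using P(2) unfolding connected_clopen by blast
  obtain \<omega> where \<omega>: "\<omega> holomorphic_on H ` U" "\<And>w. w \<in> U \<Longrightarrow> \<omega> (H w) = w"
    using holomorphic_has_inverse[OF holU openU inj] by metis
  have *: "\<omega> z \<in> U \<and> H (\<omega> z) = z" if "Im z > 0" for z
  proof -
    have "z \<in> H ` U" using that by (simp add: surj P_def)
    then show ?thesis using \<omega>(2) by auto
  qed
  show thesis
  proof (rule that)
    show "\<omega> holomorphic_on {z. Im z > 0}" using \<omega>(1) surj by (simp add: P_def)
    show "Im (\<omega> z) \<ge> Im z" "H (\<omega> z) = z" if "Im z > 0" for z
      using *[OF that] le[of "\<omega> z"] by (auto simp: U_def P_def)
    show "\<omega> (H w) = w" if "Im w > 0" "Im (H w) > 0" for w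
      using that by (intro \<omega>(2)) (auto simp: U_def P_def)
  qed
qed

section \<open>Reciprocal Cauchy transforms and the subordinated measure\<close>

context real_distribution
begin

text \<open>Nonnegativity of the variance of the kernel's modulus bounds
  \<open>(norm G)\<^sup>2\<close> by the expectation of the Poisson kernel, which is
  \<open>- Im G / Im z\<close>. That kernel is positive everywhere, whence the strict sign.\<close>

lemma cauchy_G_norm_sq_le:
  assumes z: "Im z > 0"
  shows "Im z * (norm (cauchy_G M z))\<^sup>2 \<le> - Im (cauchy_G M z)" and "Im (cauchy_G M z) < 0"
proof -
  let ?k = "\<lambda>x. norm (1 / (z - complex_of_real x))" and ?p = "\<lambda>x. 1 / ((x - Re z)\<^sup>2 + (Im z)\<^sup>2)"
  have k: "(?k x)\<^sup>2 = ?p x" for x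
    by (simp add: norm_divide power_divide cmod_power2 power2_commute)
  have int: "integrable M ?p" by (rule integrable_poisson[OF z])
  have pos: "?p x > 0" for x
    using z by (intro divide_pos_pos add_nonneg_pos) auto
  have "(norm (cauchy_G M z))\<^sup>2 \<le> (expectation ?k)\<^sup>2"
    unfolding cauchy_G_def by (intro power_mono integral_norm_bound) auto
  also have "\<dots> \<le> expectation (\<lambda>x. (?k x)\<^sup>2)"
  proof -
    have "variance ?k = expectation (\<lambda>x. (?k x)\<^sup>2) - (expectation ?k)\<^sup>2"
      by (rule variance_eq) (use integrable_norm[OF integrable_cauchy_kernel[OF z]] int k in auto)
    then show ?thesis using variance_positive[of ?k] by linarith
  qed
  also have "\<dots> = expectation ?p" by (simp only: k)
  finally show "Im z * (norm (cauchy_G M z))\<^sup>2 \<le> - Im (cauchy_G M z)"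
    unfolding Im_cauchy_G[OF z] using z by (simp add: mult_left_mono)
  have "expectation ?p \<noteq> 0"
  proof
    assume "expectation ?p = 0"
    then have "AE x in M. ?p x = 0"
      using integral_nonneg_eq_0_iff_AE[OF int] pos less_imp_le by blast
    then have "AE x in M. False"
      by (rule AE_mp) (rule AE_I2, use pos less_irrefl in metis)
    then show False by simp
  qed
  moreover have "expectation ?p \<ge> 0"
    using pos by (intro integral_nonneg_AE AE_I2 less_imp_le)
  ultimately have "expectation ?p > 0" by linarith
  then show "Im (cauchy_G M z) < 0"
    unfolding Im_cauchy_G[OF z] using z by simp
qed

lemma Im_recip_F:
  assumes z: "Im z > 0"
  shows "Im (recip_F M z) \<ge> Im z"
proof -
  have "(norm (cauchy_G M z))\<^sup>2 > 0"
    using cauchy_G_norm_sq_le(2)[OF z] by auto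
  then have "Im z \<le> - Im (cauchy_G M z) / (norm (cauchy_G M z))\<^sup>2"
    using cauchy_G_norm_sq_le(1)[OF z] by (simp only: pos_le_divide_eq)
  moreover have "Im (recip_F M z) = - Im (cauchy_G M z) / (norm (cauchy_G M z))\<^sup>2"
    unfolding recip_F_def by (simp add: Im_divide cmod_power2)
  ultimately show ?thesis by simp
qed

lemma holomorphic_recip_F: "recip_F M holomorphic_on {z. Im z > 0}"
  unfolding recip_F_def
  by (intro holomorphic_intros holomorphic_cauchy_G) (use cauchy_G_norm_sq_le(2) in fastforce)

text \<open>The equation for \<open>w\<close> says that \<open>w\<close> is a fixed point of
  \<open>\<i> * y + s * (F w - w)\<close>; Brouwer's theorem gives one in a disc of radius
  \<open>d * y\<close>, as \<open>F w - w\<close> is small relative to \<open>w\<close> in a cone.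
  These points supply a base point for inverting \<open>H\<close> and locate \<open>\<omega>\<close>
  on the imaginary axis.\<close>

lemma subordination_asymp:
  assumes s: "s \<ge> 0" and d: "0 < d" "d \<le> 1/2"
  shows "\<exists>\<beta>>0. \<forall>y>\<beta>. \<exists>w. Im w > 0 \<and> norm (w - \<i> * of_real y) \<le> d * y \<and>
    w - of_real s * (recip_F M w - w) = \<i> * of_real y \<and> norm (recip_F M w - w) \<le> d * y"
proof -
  \<comment> \<open>On the disc \<open>norm w \<le> 2 * y\<close>, so this gives
    \<open>norm (F w - w) \<le> d * y / (s + 1)\<close>; dividing by \<open>s + 1\<close> absorbs
    the factor \<open>s\<close> and also covers \<open>s = 0\<close>.\<close>
  define \<epsilon> where "\<epsilon> = d / (2 * (s + 1))"
  have \<epsilon>: "\<epsilon> > 0" using d s by (simp add: \<epsilon>_def)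
  obtain \<beta> where \<beta>: "\<beta> > 0"
    and bd: "\<And>z. z \<in> trunc_cone 3 \<beta> \<Longrightarrow> norm (recip_F M z - z) \<le> \<epsilon> * norm z"
    using recip_F_asymp[of 3, OF _ \<epsilon>] by auto
  have "\<exists>w. Im w > 0 \<and> norm (w - \<i> * of_real y) \<le> d * y \<and>
    w - of_real s * (recip_F M w - w) = \<i> * of_real y \<and> norm (recip_F M w - w) \<le> d * y"
    if y: "y > 2 * \<beta>" for y
  proof -
    let ?z = "\<i> * complex_of_real y"
    have y0: "y > 0" using y \<beta> by linarith
    have cone: "w \<in> trunc_cone 3 \<beta>" and dist: "norm (recip_F M w - w) \<le> d * y / (s + 1)"
      if w: "w \<in> cball ?z (d * y)" for w
    proof -
      have wz: "norm (w - ?z) \<le> d * y" using w by (simp add: dist_norm norm_minus_commute)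
      also have "\<dots> \<le> y / 2" using d y0 by simp
      finally have wz2: "norm (w - ?z) \<le> y / 2" .
      \<comment> \<open>The disc has radius at most \<open>y / 2\<close>, so
        \<open>trunc_cone_cball\<close> moves it into aperture \<open>3 = 2 * 1 + 1\<close>.\<close>
      have "?z \<in> trunc_cone 1 (2 * \<beta>)" using y y0 by (simp add: trunc_cone_def)
      from trunc_cone_cball[OF this _ \<beta>] wz2 show c: "w \<in> trunc_cone 3 \<beta>" by simp
      have "norm w \<le> 2 * y"
        using norm_triangle_sub[of w ?z] wz2 y0 by (simp add: norm_mult)
      then have "\<epsilon> * norm w \<le> \<epsilon> * (2 * y)" using \<epsilon> by (intro mult_left_mono) auto
      moreover have "\<epsilon> * (2 * y) = d * y / (s + 1)"
        using s by (simp add: \<epsilon>_def divide_simps)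
      ultimately show "norm (recip_F M w - w) \<le> d * y / (s + 1)"
        using bd[OF c] by linarith
    qed
    obtain w where w: "w \<in> cball ?z (d * y)" "?z + of_real s * (recip_F M w - w) = w"
    proof (rule brouwer_ball)
      show "0 < d * y" using d y0 by simp
      have "cball ?z (d * y) \<subseteq> {z. Im z > 0}" using cone by (auto simp: trunc_cone_def)
      then show "continuous_on (cball ?z (d * y)) (\<lambda>w. ?z + of_real s * (recip_F M w - w))"
        by (intro continuous_intros holomorphic_on_imp_continuous_on
            holomorphic_on_subset[OF holomorphic_recip_F])
      show "(\<lambda>w. ?z + of_real s * (recip_F M w - w)) \<in> cball ?z (d * y) \<rightarrow> cball ?z (d * y)"
      proof
        fix w assume w: "w \<in> cball ?z (d * y)"
        have "s * norm (recip_F M w - w) \<le> (s + 1) * (d * y / (s + 1))"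
          using dist[OF w] s by (intro mult_mono) auto
        also have "\<dots> = d * y" using s by simp
        finally show "?z + of_real s * (recip_F M w - w) \<in> cball ?z (d * y)"
          using s by (simp add: dist_norm norm_mult)
      qed
    qed
    have "d * y / (s + 1) \<le> d * y / 1" using s d y0 by (intro divide_left_mono) auto
    with dist[OF w(1)] have "norm (recip_F M w - w) \<le> d * y" by simp
    moreover have "w - of_real s * (recip_F M w - w) = ?z" using w(2) by (simp add: algebra_simps)
    moreover have "norm (w - ?z) \<le> d * y" using w(1) by (simp add: dist_norm norm_minus_commute)
    moreover have "Im w > 0" using cone[OF w(1)] by (simp add: trunc_cone_def)
    ultimately show ?thesis by blast
  qed
  then show ?thesis using \<beta> by (intro exI[of _ "2 * \<beta>"]) auto
qed

text \<open>With \<open>F z = recip_F M (\<omega> z)\<close>, the function \<open>1 / F\<close>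
  meets the hypotheses of \<open>cauchy_G_representation\<close>: \<open>Im (F z) \<ge> Im z\<close>
  gives the bound and the sign, and \<open>subordination_asymp\<close> the normalisation.\<close>

lemma subordinated_distribution_exists:
  assumes t: "t \<ge> 1"
  obtains \<mu>t \<omega> where "real_distribution \<mu>t" "\<omega> holomorphic_on {z. Im z > 0}"
    "\<And>z. Im z > 0 \<Longrightarrow> Im (\<omega> z) > 0" "\<And>z. Im z > 0 \<Longrightarrow> H_map t M (\<omega> z) = z"
    "\<And>z. Im z > 0 \<Longrightarrow> recip_F \<mu>t z = recip_F M (\<omega> z)"
proof -
  define s where "s = t - 1"
  define h where "h w = recip_F M w - w" for w
  have s: "s \<ge> 0" using t by (simp add: s_def)
  have H: "H_map t M w = w - of_real s * h w" for w
    by (simp add: H_map_def s_def h_def algebra_simps)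
  have holh: "h holomorphic_on {z. Im z > 0}"
    unfolding h_def by (intro holomorphic_intros holomorphic_recip_F)
  have Imh: "Im (h z) \<ge> 0" if "Im z > 0" for z
    using Im_recip_F[OF that] by (simp add: h_def)
  have asymp: "eventually (\<lambda>y. \<exists>w. Im w > 0 \<and> norm (w - \<i> * of_real y) \<le> d * y \<and>
      H_map t M w = \<i> * of_real y \<and> norm (recip_F M w - w) \<le> d * y) at_top"
    if "0 < d" "d \<le> 1/2" for d
    using subordination_asymp[OF s that]
    unfolding H h_def eventually_at_top_dense by blast
  obtain y v where v: "Im v > 0" and Hv: "H_map t M v = \<i> * of_real y" and y: "y > 0"
    using eventually_happens[OF eventually_conj[OF asymp[of "1/2"] eventually_gt_at_top[of 0]]] by auto
  have Hv': "Im (H_map t M v) > 0" using Hv y by simp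
  obtain \<omega> where hol\<omega>: "\<omega> holomorphic_on {z. Im z > 0}"
    and Im\<omega>: "\<And>z. Im z > 0 \<Longrightarrow> Im (\<omega> z) \<ge> Im z"
    and H\<omega>: "\<And>z. Im z > 0 \<Longrightarrow> H_map t M (\<omega> z) = z"
    and \<omega>H: "\<And>w. Im w > 0 \<Longrightarrow> Im (H_map t M w) > 0 \<Longrightarrow> \<omega> (H_map t M w) = w"
    using subordination_function_exists[OF holh Imh s H v Hv'] by metis
  have \<omega>pos: "Im (\<omega> z) > 0" if "Im z > 0" for z
    using Im\<omega>[OF that] that by linarith
  define F where "F z = recip_F M (\<omega> z)" for z
  have ImF: "Im (F z) \<ge> Im z" if "Im z > 0" for z
    using Im_recip_F[OF \<omega>pos[OF that]] Im\<omega>[OF that] by (simp add: F_def)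
  have "(recip_F M \<circ> \<omega>) holomorphic_on {z. Im z > 0}"
    by (rule holomorphic_on_compose_gen[OF hol\<omega> holomorphic_recip_F]) (use \<omega>pos in auto)
  then have holF: "F holomorphic_on {z. Im z > 0}" by (simp add: F_def[abs_def] o_def)
  have "((\<lambda>y. F (\<i> * of_real y) / (\<i> * of_real y)) \<longlongrightarrow> 1) at_top"
  proof (rule tendstoI)
    fix e :: real assume e: "e > 0"
    define d where "d = min (1/2) (e / 3)"
    have d: "d > 0" "d \<le> 1/2" "2 * d < e" using e by (auto simp: d_def)
    show "eventually (\<lambda>y. dist (F (\<i> * of_real y) / (\<i> * of_real y)) 1 < e) at_top"
      using asymp[OF d(1,2)] eventually_gt_at_top[of 0]
    proof eventually_elim
      case (elim y)
      then obtain w where w: "Im w > 0" "norm (w - \<i> * of_real y) \<le> d * y"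
        "H_map t M w = \<i> * of_real y" "norm (recip_F M w - w) \<le> d * y" by blast
      \<comment> \<open>\<open>\<omega>\<close> is a left inverse of \<open>H\<close> here, so the
        point found by Brouwer's theorem is its value at \<open>\<i> * y\<close>.\<close>
      then have "\<omega> (\<i> * of_real y) = w" using \<omega>H[of w] elim by simp
      then have "norm (F (\<i> * of_real y) - \<i> * of_real y) \<le> 2 * d * y"
        using norm_triangle_ineq[of "recip_F M w - w" "w - \<i> * of_real y"] w by (simp add: F_def)
      also have "\<dots> < e * y" using d elim by simp
      finally have "norm (F (\<i> * of_real y) - \<i> * of_real y) < e * y" .
      moreover have "F (\<i> * of_real y) / (\<i> * of_real y) - 1
          = (F (\<i> * of_real y) - \<i> * of_real y) / (\<i> * of_real y)"
        using elim by (simp add: diff_divide_distrib)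
      ultimately show ?case
        using elim by (simp only: dist_norm norm_divide norm_mult) (simp add: pos_divide_less_eq)
    qed
  qed
  then have "((\<lambda>y. inverse (F (\<i> * of_real y) / (\<i> * of_real y))) \<longlongrightarrow> inverse 1) at_top"
    by (intro tendsto_inverse) auto
  then have lim: "((\<lambda>y. \<i> * of_real y * (1 / F (\<i> * of_real y))) \<longlongrightarrow> 1) at_top"
    by (simp add: field_simps)
  obtain \<mu>t where \<mu>t: "real_distribution \<mu>t" "\<And>z. Im z > 0 \<Longrightarrow> cauchy_G \<mu>t z = 1 / F z"
  proof -
    have nz: "F z \<noteq> 0" if "Im z > 0" for z using ImF[OF that] that by auto
    have "\<exists>N. real_distribution N \<and> (\<forall>z. Im z > 0 \<longrightarrow> cauchy_G N z = 1 / F z)"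
    proof (rule cauchy_G_representation[OF _ _ _ lim])
      show "(\<lambda>z. 1 / F z) holomorphic_on {z. Im z > 0}"
        using nz by (intro holomorphic_intros holF) auto
      show "norm (1 / F z) \<le> 1 / Im z" if z: "Im z > 0" for z
      proof -
        have "Im z \<le> norm (F z)" using ImF[OF z] abs_Im_le_cmod[of "F z"] by linarith
        then show ?thesis using z by (simp add: norm_divide frac_le)
      qed
      show "Im (1 / F z) \<le> 0" if z: "Im z > 0" for z
        using ImF[OF z] z by (simp add: Im_divide divide_nonpos_nonneg)
    qed
    then show thesis using that by blast
  qed
  show thesis
    by (rule that[OF \<mu>t(1) hol\<omega> \<omega>pos H\<omega>]) (simp_all add: recip_F_def \<mu>t(2), simp add: F_def recip_F_def)
qed

text \<open>In a cone \<open>norm z \<le> (1 + a) * Im z\<close>, so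
  \<open>g z / z \<rightarrow> 1\<close> gives an error measured in \<open>Im z\<close>, as
  \<open>trunc_cone_cball\<close> requires.\<close>

lemma right_inverse_near:
  assumes "F_right_inverse_on M \<Omega> g" and a: "a > 0" and b: "b > 0"
  shows "\<exists>R. \<forall>z\<in>trunc_cone a b. norm z \<ge> R \<longrightarrow> norm (g z - z) \<le> Im z / 2"
proof -
  define d where "d = 1 / (2 * (1 + a))"
  have d: "d > 0" using a by (simp add: d_def)
  have "((\<lambda>z. g z / z) \<longlongrightarrow> 1) (inf at_infinity (principal (trunc_cone a b)))"
    using assms by (simp add: F_right_inverse_on_def)
  then have "eventually (\<lambda>z. dist (g z / z) 1 < d) (inf at_infinity (principal (trunc_cone a b)))"
    using d by (rule tendstoD)
  then obtain R where R: "\<And>z. norm z \<ge> R \<Longrightarrow> z \<in> trunc_cone a b \<Longrightarrow> dist (g z / z) 1 < d"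
    unfolding eventually_inf_principal eventually_at_infinity by blast
  have "norm (g z - z) \<le> Im z / 2" if z: "z \<in> trunc_cone a b" "norm z \<ge> R" for z
  proof -
    have z0: "z \<noteq> 0" using z(1) by (auto simp: trunc_cone_def)
    then have "norm (g z - z) = norm (g z / z - 1) * norm z"
      by (simp flip: norm_mult add: left_diff_distrib)
    also have "\<dots> \<le> d * ((1 + a) * Im z)"
      using R[OF z(2,1)] trunc_cone_norm[OF z(1)] d
      by (intro mult_mono) (auto simp: dist_norm)
    also have "\<dots> = (d * (1 + a)) * Im z" by simp
    also have "d * (1 + a) = 1 / 2" unfolding d_def using a by (simp add: divide_simps)
    finally show ?thesis by simp
  qed
  then show ?thesis by blast
qed

end

section \<open>The relation between the Voiculescu transforms\<close>

text \<open>The smaller aperture and the larger height serve both domains. The single cone is a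
  connected set joining \<open>z\<close> to infinity, on which the identity theorem can be
  applied.\<close>

lemma cone_domain_Int_cone:
  assumes "cone_domain \<Omega>1" "cone_domain \<Omega>2" "z \<in> \<Omega>1 \<inter> \<Omega>2"
  obtains a b where "a > 0" "b > 0" "z \<in> trunc_cone a b" "trunc_cone a b \<subseteq> \<Omega>1 \<inter> \<Omega>2"
proof -
  obtain b1 b2 where b: "\<And>a. a > 0 \<Longrightarrow> b1 a > 0" "\<And>a. a > 0 \<Longrightarrow> b2 a > (0::real)"
    and \<Omega>: "\<Omega>1 = (\<Union>a\<in>{0<..}. trunc_cone a (b1 a))" "\<Omega>2 = (\<Union>a\<in>{0<..}. trunc_cone a (b2 a))"
    using assms(1,2) unfolding cone_domain_def by metis
  obtain a1 a2 where a: "a1 > 0" "a2 > 0" "z \<in> trunc_cone a1 (b1 a1)" "z \<in> trunc_cone a2 (b2 a2)"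
    using assms(3) unfolding \<Omega> by auto
  let ?C = "trunc_cone (min a1 a2) (max (b1 a1) (b2 a2))"
  have "?C \<subseteq> trunc_cone a1 (b1 a1)" "?C \<subseteq> trunc_cone a2 (b2 a2)"
    by (auto simp: trunc_cone_def intro: less_le_trans mult_right_mono)
  then have "?C \<subseteq> \<Omega>1 \<inter> \<Omega>2" using a(1,2) unfolding \<Omega> by blast
  moreover have "z \<in> ?C" using a(3,4) by (auto simp: trunc_cone_def min_def)
  ultimately show thesis using that[of "min a1 a2" "max (b1 a1) (b2 a2)"] a(1,2) b by (auto simp: less_max_iff_disj)
qed

text \<open>High in a cone, \<open>\<omega> (gt z)\<close> and \<open>g z\<close> are both preimages
  of \<open>z\<close> under \<open>recip_F \<mu>\<close> and both lie in a wider cone where this map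
  is injective, so they agree. The formula for \<open>\<omega>\<close> then becomes the claim, and
  the identity theorem carries it down to \<open>z0\<close>.\<close>

lemma voiculescu_transform_subordination:
  assumes \<mu>: "real_distribution \<mu>" and \<mu>t: "real_distribution \<mu>t" and t: "t \<ge> 1"
    and sub: "\<And>z. Im z > 0 \<Longrightarrow> recip_F \<mu>t z = recip_F \<mu> (\<omega> z)"
    and \<omega>: "\<And>z. Im z > 0 \<Longrightarrow> \<omega> z = 1 / of_real t * z + (1 - 1 / of_real t) * recip_F \<mu>t z"
    and V: "voiculescu_transform_on \<mu> \<Omega> \<phi>" and Vt: "voiculescu_transform_on \<mu>t \<Omega>t \<phi>t"
    and z0: "z0 \<in> \<Omega>t \<inter> \<Omega>"
  shows "\<phi>t z0 = of_real t * \<phi> z0"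
proof -
  interpret \<mu>: real_distribution \<mu> by (rule \<mu>)
  interpret \<mu>t: real_distribution \<mu>t by (rule \<mu>t)
  obtain g where g: "F_right_inverse_on \<mu> \<Omega> g" and \<phi>: "\<And>z. z \<in> \<Omega> \<Longrightarrow> \<phi> z = g z - z"
    using V by (auto simp: voiculescu_transform_on_def)
  obtain gt where gt: "F_right_inverse_on \<mu>t \<Omega>t gt" and \<phi>t: "\<And>z. z \<in> \<Omega>t \<Longrightarrow> \<phi>t z = gt z - z"
    using Vt by (auto simp: voiculescu_transform_on_def)
  obtain a b where a: "a > 0" and b: "b > 0" and z0C: "z0 \<in> trunc_cone a b"
    and C: "trunc_cone a b \<subseteq> \<Omega>t \<inter> \<Omega>"
    using cone_domain_Int_cone[OF _ _ z0] V Vt by (auto simp: voiculescu_transform_on_def)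
  obtain \<beta> where \<beta>: "\<beta> > 0" and inj: "inj_on (recip_F \<mu>) (trunc_cone (2 * a + 1) \<beta>)"
    using \<mu>.recip_F_inj[of "2 * a + 1"] a by auto
  obtain R where R: "\<And>z. z \<in> trunc_cone a b \<Longrightarrow> norm z \<ge> R \<Longrightarrow> norm (g z - z) \<le> Im z / 2"
    using \<mu>.right_inverse_near[OF g a b] by blast
  obtain Rt where Rt: "\<And>z. z \<in> trunc_cone a b \<Longrightarrow> norm z \<ge> Rt \<Longrightarrow> norm (gt z - z) \<le> Im z / 2"
    using \<mu>t.right_inverse_near[OF gt a b] by blast
  \<comment> \<open>Height \<open>B\<close> secures membership in the common cone, both distance
    bounds, and a wider cone above height \<open>\<beta>\<close>.\<close>
  define B where "B = Max {b, R, Rt, 2 * \<beta>}"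
  have B: "b \<le> B" "R \<le> B" "Rt \<le> B" "2 * \<beta> \<le> B" by (auto simp: B_def)
  have sub_cone: "trunc_cone a B \<subseteq> trunc_cone a b"
    using B by (auto simp: trunc_cone_def)
  have eq: "gt z - z = of_real t * (g z - z)" if z: "z \<in> trunc_cone a B" for z
  proof -
    have zC: "z \<in> trunc_cone a b" using z sub_cone by blast
    then have z\<Omega>: "z \<in> \<Omega>" "z \<in> \<Omega>t" using C by auto
    have "norm z \<ge> B" using z abs_Im_le_cmod[of z] by (auto simp: trunc_cone_def)
    then have near: "norm (g z - z) \<le> Im z / 2" "norm (gt z - z) \<le> Im z / 2"
      using R[OF zC] Rt[OF zC] B by auto
    have z2: "z \<in> trunc_cone a (2 * \<beta>)" using z B by (auto simp: trunc_cone_def)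
    have Fg: "recip_F \<mu> (g z) = z" using g z\<Omega> by (auto simp: F_right_inverse_on_def)
    have Fgt: "recip_F \<mu>t (gt z) = z" "Im (gt z) > 0"
      using gt z\<Omega> by (auto simp: F_right_inverse_on_def upper_half_plane_def)
    define v where "v = \<omega> (gt z)"
    have Fv: "recip_F \<mu> v = z" using sub[OF Fgt(2)] Fgt(1) by (simp add: v_def)
    \<comment> \<open>Since \<open>t \<ge> 1\<close>, \<open>v\<close> is a convex combination of
      \<open>gt z\<close> and \<open>z\<close>, hence no farther from \<open>z\<close> than
      \<open>gt z\<close> is.\<close>
    have v: "v = 1 / of_real t * gt z + (1 - 1 / of_real t) * z"
      using \<omega>[OF Fgt(2)] Fgt(1) by (simp add: v_def)
    then have vz: "v - z = (gt z - z) / of_real t"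
      by (simp add: algebra_simps diff_divide_distrib)
    then have "norm (v - z) = norm (gt z - z) / t" using t by (simp add: norm_divide)
    also have "\<dots> \<le> norm (gt z - z)" using t mult_left_mono[of 1 t "norm (gt z - z)"] by (simp add: divide_le_eq)
    finally have "norm (v - z) \<le> Im z / 2" using near by linarith
    then have "v \<in> trunc_cone (2 * a + 1) \<beta>" "g z \<in> trunc_cone (2 * a + 1) \<beta>"
      using trunc_cone_cball[OF z2 a \<beta>] near by auto
    then have "v = g z" using inj Fv Fg by (auto dest: inj_onD)
    then show ?thesis using vz t by (simp add: field_simps)
  qed
  have "gt z0 - z0 = of_real t * (g z0 - z0)"
  proof (rule analytic_continuation_open[where s = "trunc_cone a B" and s' = "trunc_cone a b"
        and f = "\<lambda>z. gt z - z" and g = "\<lambda>z. of_real t * (g z - z)"])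
    have "\<i> * of_real (\<bar>B\<bar> + 1) \<in> trunc_cone a B"
      using a abs_ge_self[of B] by (simp add: trunc_cone_def add_nonneg_pos le_less_trans)
    then show "trunc_cone a B \<noteq> {}" by blast
    show "(\<lambda>z. gt z - z) holomorphic_on trunc_cone a b"
      using gt C by (auto intro!: holomorphic_intros simp: F_right_inverse_on_def elim: holomorphic_on_subset)
    show "(\<lambda>z. of_real t * (g z - z)) holomorphic_on trunc_cone a b"
      using g C by (auto intro!: holomorphic_intros simp: F_right_inverse_on_def elim: holomorphic_on_subset)
  qed (use eq sub_cone z0C in \<open>auto simp: open_trunc_cone convex_trunc_cone convex_connected\<close>)
  then show ?thesis using \<phi> \<phi>t z0 by simp
qed

theorem theorem2p2:
  fixes \<mu> :: "real measure" and t :: real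
  assumes "real_distribution \<mu>" and "t \<ge> 1"
  shows "\<exists>\<mu>t :: real measure.
    real_distribution \<mu>t \<and>
    (\<forall>\<Omega> \<phi> \<Omega>t \<phi>t.
       voiculescu_transform_on \<mu> \<Omega> \<phi> \<longrightarrow> voiculescu_transform_on \<mu>t \<Omega>t \<phi>t \<longrightarrow>
       (\<forall>z\<in>\<Omega>t \<inter> \<Omega>. \<phi>t z = of_real t * \<phi> z)) \<and>
    (\<exists>\<omega> :: complex \<Rightarrow> complex.
       \<omega> analytic_on upper_half_plane \<and>
       inj_on \<omega> upper_half_plane \<and>
       \<omega> ` upper_half_plane \<subseteq> upper_half_plane \<and>
       (\<forall>z\<in>upper_half_plane. recip_F \<mu>t z = recip_F \<mu> (\<omega> z)) \<and>
       (\<forall>z\<in>upper_half_plane.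
          \<omega> z = 1 / of_real t * z + (1 - 1 / of_real t) * recip_F \<mu>t z \<and>
          H_map t \<mu> (\<omega> z) = z))"
proof -
  interpret real_distribution \<mu> by (rule assms)
  obtain \<mu>t \<omega> where \<mu>t: "real_distribution \<mu>t" and hol: "\<omega> holomorphic_on {z. Im z > 0}"
    and pos: "\<And>z. Im z > 0 \<Longrightarrow> Im (\<omega> z) > 0" and H: "\<And>z. Im z > 0 \<Longrightarrow> H_map t \<mu> (\<omega> z) = z"
    and F: "\<And>z. Im z > 0 \<Longrightarrow> recip_F \<mu>t z = recip_F \<mu> (\<omega> z)"
    using subordinated_distribution_exists[OF assms(2)] by metis
  \<comment> \<open>The equation \<open>H_map t \<mu> (\<omega> z) = z\<close>, solved for its
    linear term after \<open>recip_F \<mu> (\<omega> z)\<close> is replaced by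
    \<open>recip_F \<mu>t z\<close>.\<close>
  have \<omega>: "\<omega> z = 1 / of_real t * z + (1 - 1 / of_real t) * recip_F \<mu>t z" if z: "Im z > 0" for z
  proof -
    have "of_real t * \<omega> z = z + (of_real t - 1) * recip_F \<mu>t z"
      using H[OF z] by (simp add: H_map_def F[OF z] algebra_simps)
    moreover have "complex_of_real t \<noteq> 0" using assms(2) by simp
    ultimately show ?thesis by (simp add: field_simps)
  qed
  have "inj_on \<omega> {z. Im z > 0}"
    by (rule inj_on_inverseI[of _ "H_map t \<mu>"]) (simp add: H)
  moreover have "\<omega> analytic_on {z. Im z > 0}"
    using hol by (simp add: analytic_on_open open_halfspace_Im_gt)
  moreover have transform: "\<forall>\<Omega> \<phi> \<Omega>t \<phi>t.
       voiculescu_transform_on \<mu> \<Omega> \<phi> \<longrightarrow> voiculescu_transform_on \<mu>t \<Omega>t \<phi>t \<longrightarrow>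
       (\<forall>z\<in>\<Omega>t \<inter> \<Omega>. \<phi>t z = of_real t * \<phi> z)"
    using voiculescu_transform_subordination[OF assms(1) \<mu>t assms(2) F \<omega>] by blast
  ultimately have "\<omega> analytic_on {z. Im z > 0} \<and> inj_on \<omega> {z. Im z > 0} \<and>
      \<omega> ` {z. Im z > 0} \<subseteq> {z. Im z > 0} \<and>
      (\<forall>z\<in>{z. Im z > 0}. recip_F \<mu>t z = recip_F \<mu> (\<omega> z)) \<and>
      (\<forall>z\<in>{z. Im z > 0}.
        \<omega> z = 1 / of_real t * z + (1 - 1 / of_real t) * recip_F \<mu>t z \<and> H_map t \<mu> (\<omega> z) = z)"
    using pos F \<omega> H by blast
  with \<mu>t transform show ?thesis
    unfolding upper_half_plane_def by blast
qed

end
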